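(* Suppose the Boundedness, Link-function, Demand-shock, and Known-price-coefficient-and-smoothness assumptions stated in the context hold (so $\beta^*$ is known). Then for any sequence of covariates $x_1,\dots,x_T\in\mathcal X$, the regret $\mathrm{Reg}_T^\pi(x_1,\dots,x_T)$ of the certainty-equivalent pricing algorithm (described in the context) run with regularization parameter $\lambda=1$ is at most $$2C\,\bar\gamma'^{\,2}\,d\log\left(\frac{d+T}{d}\right)+\bar p\bar D=\tilde O(d^2\log^2T),$$ where $\bar\gamma'=2\bar\theta+\frac{2\bar\sigma}{\underline g}\sqrt{2\log T+d\log\left(\frac{d+T}{d}\right)}$ and $C$ is the constant in the smoothness assumption.
   Context: Model. For $t=1,\dots,T$ the seller observes $x_t\in\mathcal X\subset\mathbb R^d$, sets a price $p_t\in[\underline p,\bar p]$ with $0\le\underline p\le\bar p$, and observes the demand $D_t=g(x_t^\top\alpha^*+x_t^\top\beta^*\cdot p_t)+\epsilon_t$. Here $g:\mathbb R\to\mathbb R$ is known, $\theta^*=(\alpha^*,\beta^* )\in\mathbb R^{2d}$. Boundedness. $\theta^*\in\Theta:=\{\theta\in\mathbb R^{2d}:\|\theta\|_2\le\bar\theta\}$ for some $\bar\theta>0$; $0\le g(x^\top\alpha^*+x^\top\beta^*p)\le\bar D$ and $\|(x,px)\|_2\le1$ for all $x\in\mathcal X$, $p\in[\underline p,\bar p]$. Link function. $g$ is strictly increasing and differentiable, and there are constants with $0<\underline g\le g'(z)\le\bar g<\infty$ for all $z=x^\top\alpha+x^\top\beta p$ with $x\in\mathcal X$, $(\alpha,\beta)\in\Theta$,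 $p\in[\underline p,\bar p]$. Demand shock. With $\mathcal H_t=\sigma(p_1,\dots,p_t,\epsilon_1,\dots,\epsilon_t,x_1,\dots,x_{t+1})$ and $\mathcal H_0$ trivial, $\mathbb E[\epsilon_t|\mathcal H_{t-1}]=0$ and $\log\mathbb E[e^{s\epsilon_t}|\mathcal H_{t-1}]\le\bar\sigma^2s^2/2$ for all $s\in\mathbb R$ and all $t$; $\bar\sigma$ is known. Revenue and regret. $r(p;a,b)=p\,g(a+bp)$, $r^*(a,b)=\max_{p\in[\underline p,\bar p]}r(p;a,b)$, and $p^*((\alpha,\beta),x)=\arg\max_{p\in[\underline p,\bar p]}r(p;x^\top\alpha,x^\top\beta)$. For a non-anticipating policy producing prices $p_t$, $\mathrm{Reg}_T^\pi(x_1,\dots,x_T)=\sum_{t=1}^T r^*(x_t^\top\alpha^*,x_t^\top\beta^* )-\mathbb E[\sum_{t=1}^T p_tD_t]$. Known price coefficient and smoothness. $\beta^*$ is known to the seller, and there is a constant $C$ such that $|r^*(x^\top\alpha^*,x^\top\beta^* )-r(p^*(\theta,x);x^\top\alpha^*,x^\top\beta^* )|\le C(x^\top\alpha^*-x^\top\alpha)^2$ for all $x\in\mathcal X$ and all $\theta,\theta^*\in\Theta$ with $\theta=(\alpha,\beta^* )$, $\theta^*=(\alpha^*,\beta^* )$. Estimator. $\tilde l_t(\alpha)=-\int_{D_t}^{g(x_t^\top\alpha+x_t^\top\beta^*p_t)}\frac{u-D_t}{h(u)}du$ with $h(u)=g'(g^{-1}(u))$ (up to a constant not depending on $\alpha$,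 the function with gradient $(D_t-g(x_t^\top\alpha+x_t^\top\beta^*p_t))x_t$); $\Theta_\alpha=\{\alpha:(\alpha,\beta^* )\in\Theta\}$; $\hat\alpha_t=\arg\max_{\alpha\in\Theta_\alpha}\{-\frac{\lambda\underline g}{2}\|\alpha\|_2^2+\sum_{s=1}^t\tilde l_s(\alpha)\}$. Certainty-equivalent pricing algorithm. At each $t$: compute $\hat\alpha_{t-1}$, observe $x_t$, and set $p_t=p^*((\hat\alpha_{t-1},\beta^* ),x_t)$. *)

theory Defs
  imports "HOL-Probability.Probability" "HOL-Library.Landau_Symbols"
begin

definition param_ball :: "real \<Rightarrow> ((real ^ 'd) \<times> (real ^ 'd)) set" where
  "param_ball tbar = {\<theta>. norm \<theta> \<le> tbar}"

definition revenue :: "(real \<Rightarrow> real) \<Rightarrow> real \<Rightarrow> real \<Rightarrow> real \<Rightarrow> real" where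
  "revenue g p a b = p * g (a + b * p)"

text \<open>For continuous \<open>g\<close> and \<open>plo \<le> phi\<close> the supremum is attained, so it is the maximum.\<close>

definition opt_revenue :: "(real \<Rightarrow> real) \<Rightarrow> real \<Rightarrow> real \<Rightarrow> real \<Rightarrow> real \<Rightarrow> real" where
  "opt_revenue g plo phi a b = (SUP p\<in>{plo..phi}. revenue g p a b)"

text \<open>The revenue need not have a unique maximiser, so the optimal price is an arbitrary
  selection \<open>pstar\<close> from the set of maximisers.\<close>

definition optimal_price ::
  "(real \<Rightarrow> real) \<Rightarrow> real \<Rightarrow> real \<Rightarrow> real \<Rightarrow> (real ^ 'd) set \<Rightarrow>
    ((real ^ 'd) \<times> (real ^ 'd) \<Rightarrow> real ^ 'd \<Rightarrow> real) \<Rightarrow> bool" where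
  "optimal_price g tbar plo phi X pstar \<longleftrightarrow>
    (\<forall>\<theta>\<in>param_ball tbar. \<forall>x\<in>X.
      is_arg_max (\<lambda>p. revenue g p (x \<bullet> fst \<theta>) (x \<bullet> snd \<theta>)) (\<lambda>p. p \<in> {plo..phi}) (pstar \<theta> x))"

definition demand ::
  "(real \<Rightarrow> real) \<Rightarrow> real ^ 'd \<Rightarrow> real ^ 'd \<Rightarrow> (nat \<Rightarrow> real ^ 'd) \<Rightarrow> (nat \<Rightarrow> 'w \<Rightarrow> real) \<Rightarrow>
    (nat \<Rightarrow> 'w \<Rightarrow> real) \<Rightarrow> nat \<Rightarrow> 'w \<Rightarrow> real" where
  "demand g \<alpha> \<beta> x p \<epsilon> t \<omega> = g (x t \<bullet> \<alpha> + x t \<bullet> \<beta> * p t \<omega>) + \<epsilon> t \<omega>"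

text \<open>The sigma-algebra generated by \<open>p\<^sub>1, \<dots>, p\<^sub>t, \<epsilon>\<^sub>1, \<dots>, \<epsilon>\<^sub>t, x\<^sub>1, \<dots>, x\<^sub>t\<^sub>+\<^sub>1\<close>. The covariate sequence
  is a fixed one, so it enters as constant random variables, and \<open>history M x p \<epsilon> 0\<close> is trivial.\<close>

definition history ::
  "'w measure \<Rightarrow> (nat \<Rightarrow> real ^ 'd) \<Rightarrow> (nat \<Rightarrow> 'w \<Rightarrow> real) \<Rightarrow> (nat \<Rightarrow> 'w \<Rightarrow> real) \<Rightarrow> nat \<Rightarrow> 'w measure" where
  "history M x p \<epsilon> t = sigma (space M)
     ({p s -` A \<inter> space M | s A. s \<in> {1..t} \<and> A \<in> sets borel} \<union>
      {\<epsilon> s -` A \<inter> space M | s A. s \<in> {1..t} \<and> A \<in> sets borel} \<union>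
      {(\<lambda>\<omega>. x s) -` A \<inter> space M | s A. s \<in> {1..Suc t} \<and> A \<in> sets borel})"

text \<open>The log-likelihood term of one observation with covariate \<open>x\<close>, price \<open>p\<close> and demand \<open>D\<close>, as a
  function of \<open>\<alpha>\<close>. The term \<open>- (\<integral>u=D..g (x \<bullet> \<alpha> + x \<bullet> \<beta> * p). (u - D) / g' (g\<inverse> u))\<close> is determined
  only up to a summand independent of \<open>\<alpha>\<close>; here the lower endpoint is the mean demand at \<open>\<alpha> = 0\<close>
  instead of \<open>D\<close>. A noisy demand \<open>D\<close> can lie outside the range of \<open>g\<close>, where \<open>g\<inverse>\<close> is
  undefined and the integral from \<open>D\<close> need not converge. Lemma \<open>quasi_loglik_shift\<close> shows
  agreement with the integral from \<open>D\<close> up to a constant when the latter exists, and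
  \<open>quasi_loglik_gradient\<close> that the gradient is \<open>(D - g (x \<bullet> \<alpha> + x \<bullet> \<beta> * p)) x\<close>.\<close>

definition quasi_loglik ::
  "(real \<Rightarrow> real) \<Rightarrow> real ^ 'd \<Rightarrow> real ^ 'd \<Rightarrow> real \<Rightarrow> real \<Rightarrow> real ^ 'd \<Rightarrow> real" where
  "quasi_loglik g \<beta> x p D \<alpha> =
     - (LBINT u=g (x \<bullet> \<beta> * p)..g (x \<bullet> \<alpha> + x \<bullet> \<beta> * p). (u - D) / deriv g (inv g u))"

lemma quasi_loglik_shift:
  assumes "interval_lebesgue_integrable lborel (min D (min (g (x \<bullet> \<beta> * p)) (g (x \<bullet> \<alpha> + x \<bullet> \<beta> * p))))
             (max D (max (g (x \<bullet> \<beta> * p)) (g (x \<bullet> \<alpha> + x \<bullet> \<beta> * p)))) (\<lambda>u. (u - D) / deriv g (inv g u))"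
  shows "- (LBINT u=D..g (x \<bullet> \<alpha> + x \<bullet> \<beta> * p). (u - D) / deriv g (inv g u))
    = quasi_loglik g \<beta> x p D \<alpha> - (LBINT u=D..g (x \<bullet> \<beta> * p). (u - D) / deriv g (inv g u))"
  unfolding quasi_loglik_def
  by (subst interval_integral_sum[symmetric, of D "g (x \<bullet> \<beta> * p)"])
     (use assms in \<open>simp_all add: ereal_min ereal_max\<close>)

lemma link_substitution_le:
  fixes g :: "real \<Rightarrow> real"
  assumes mono: "strict_mono g" and diff: "\<And>z. g differentiable (at z)"
    and G: "\<And>z. (G has_real_derivative (g z - D)) (at z)"
    and m: "0 < m" "\<And>z. z \<in> {z0..z1} \<Longrightarrow> m \<le> deriv g z" and le: "z0 \<le> z1"
  shows "(LBINT u=g z0..g z1. (u - D) / deriv g (inv g u)) = G z1 - G z0"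
proof -
  define A where "A = {g z0..g z1}"
  define f where "f = (\<lambda>u. (u - D) / deriv g (inv g u))"
  have inj: "inj g" using mono by (rule strict_mono_imp_inj_on)
  have inv_g: "inv g (g z) = z" for z using inj by simp
  have der: "(g has_real_derivative deriv g z) (at z)" for z
    using diff DERIV_deriv_iff_real_differentiable by blast
  have cont: "isCont g z" for z using der DERIV_isCont by blast
  have contg: "continuous_on S g" for S by (simp add: cont continuous_at_imp_continuous_on)
  have range: "\<exists>z. a \<le> z \<and> z \<le> b \<and> g z = u" if "g a \<le> u" "u \<le> g b" "a \<le> b" for a b u
    using IVT'[of g a u b] that contg by auto
  have isCont_inv: "isCont (inv g) (g z)" for z
    by (rule isCont_inverse_function[where d=1]) (simp_all add: inv_g cont)
  have gle: "g z0 \<le> g z1" using le mono by (simp add: strict_mono_less_eq)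
  have A: "\<exists>z\<in>{z0..z1}. u = g z" if "u \<in> A" for u
    using range[of z0 u z1] that le unfolding A_def by auto
  have der_inv: "(inv g has_real_derivative inverse (deriv g z)) (at (g z))" if "z \<in> {z0..z1}" for z
  proof (rule DERIV_inverse_function[where f=g and a="g (z - 1)" and b="g (z + 1)"])
    show "(g has_real_derivative deriv g z) (at (inv g (g z)))" using der by (simp add: inv_g)
    show "deriv g z \<noteq> 0" using m that by force
    show "g (z - 1) < g z" "g z < g (z + 1)" using mono by (auto simp: strict_mono_less)
    show "g (inv g y) = y" if "g (z - 1) < y" "y < g (z + 1)" for y
      using range[of "z - 1" y "z + 1"] that inv_g by force
    show "isCont (inv g) (g z)" by (rule isCont_inv)
  qed
  have "(f has_integral G (inv g (g z1)) - G (inv g (g z0))) {g z0..g z1}"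
  proof (rule fundamental_theorem_of_calculus[OF gle])
    fix u assume "u \<in> {g z0..g z1}"
    then obtain z where z: "z \<in> {z0..z1}" "u = g z" using A unfolding A_def by blast
    have "(G has_real_derivative (g z - D)) (at (inv g (g z)))" using G by (simp add: inv_g)
    from DERIV_chain2[OF this der_inv[OF z(1)]]
    have "((\<lambda>u. G (inv g u)) has_real_derivative f u) (at u)"
      by (simp add: f_def z(2) inv_g divide_inverse)
    then show "((\<lambda>u. G (inv g u)) has_vector_derivative f u) (at u within {g z0..g z1})"
      using has_real_derivative_iff_has_vector_derivative has_vector_derivative_at_within by blast
  qed
  then have int: "integral A f = G z1 - G z0" by (simp add: inv_g integral_unique A_def)
  have meas_deriv: "deriv g \<in> borel_measurable borel"
  proof (rule borel_measurable_LIMSEQ_real)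
    fix z
    have "(\<lambda>h. (g (z + h) - g z) / h) \<midarrow>0\<rightarrow> deriv g z" using der by (simp add: DERIV_def)
    moreover have "filterlim (\<lambda>n. inverse (real (Suc n))) (at 0) sequentially"
      using LIMSEQ_inverse_real_of_nat by (simp add: filterlim_at)
    ultimately show "(\<lambda>n. (g (z + inverse (real (Suc n))) - g z) / inverse (real (Suc n)))
        \<longlonglongrightarrow> deriv g z"
      by (rule filterlim_compose)
  next
    have [measurable]: "g \<in> borel_measurable borel" by (simp add: borel_measurable_continuous_onI contg)
    show "(\<lambda>z. (g (z + inverse (real (Suc n))) - g z) / inverse (real (Suc n))) \<in> borel_measurable borel" for n
      by measurable
  qed
  have cinv: "continuous_on A (inv g)"
    using A isCont_inv by (metis continuous_at_imp_continuous_on)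
  have h: "(\<lambda>u. indicator A u *\<^sub>R inv g u) \<in> borel_measurable borel"
    by (rule borel_measurable_continuous_on_indicator) (auto simp: A_def cinv[unfolded A_def])
  have [measurable]: "A \<in> sets borel" by (simp add: A_def)
  have "(\<lambda>u. indicator A u *\<^sub>R ((u - D) / deriv g (indicator A u *\<^sub>R inv g u))) \<in> borel_measurable borel"
    using measurable_compose[OF h meas_deriv] by measurable
  moreover have "(\<lambda>u. indicator A u *\<^sub>R ((u - D) / deriv g (indicator A u *\<^sub>R inv g u)))
      = (\<lambda>u. indicator A u *\<^sub>R f u)"
    by (auto simp: f_def indicator_def)
  ultimately have meas: "(\<lambda>u. indicator A u *\<^sub>R f u) \<in> borel_measurable borel" by simp
  define B where "B = (\<bar>g z0\<bar> + \<bar>g z1\<bar> + \<bar>D\<bar>) / m"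
  have bnd: "\<bar>f u\<bar> \<le> B" if "u \<in> A" for u
  proof -
    obtain z where z: "z \<in> {z0..z1}" "u = g z" using A \<open>u \<in> A\<close> by blast
    have "m \<le> deriv g z" using m z by blast
    moreover have "\<bar>u - D\<bar> \<le> \<bar>g z0\<bar> + \<bar>g z1\<bar> + \<bar>D\<bar>" using \<open>u \<in> A\<close> unfolding A_def by auto
    ultimately have "\<bar>u - D\<bar> / \<bar>deriv g z\<bar> \<le> B"
      unfolding B_def using m(1) by (intro frac_le) auto
    then show ?thesis by (simp add: f_def z inv_g)
  qed
  have "set_integrable lborel A f"
    unfolding set_integrable_def
  proof (rule Bochner_Integration.integrable_bound)
    show "integrable lborel (\<lambda>u. indicator A u *\<^sub>R B)"
      unfolding A_def using gle by (auto intro!: integrable_real_indicator)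
    show "AE u in lborel. norm (indicat_real A u *\<^sub>R f u) \<le> norm (indicat_real A u *\<^sub>R B)"
      using bnd by (intro AE_I2) (force simp: indicator_def)
  qed (use meas in simp)
  then have "(LBINT u=g z0..g z1. f u) = integral A f"
    unfolding A_def by (rule interval_integral_eq_integral[OF gle])
  then show ?thesis using int unfolding f_def by (rule trans)
qed

lemma link_substitution:
  fixes g :: "real \<Rightarrow> real"
  assumes "strict_mono g" "\<And>z. g differentiable (at z)"
    and "\<And>z. (G has_real_derivative (g z - D)) (at z)"
    and "0 < m" "\<And>z. z \<in> closed_segment z0 z1 \<Longrightarrow> m \<le> deriv g z"
  shows "(LBINT u=g z0..g z1. (u - D) / deriv g (inv g u)) = G z1 - G z0"
proof (cases "z0 \<le> z1")
  case True
  then show ?thesis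
    using assms by (intro link_substitution_le[where m=m]) (auto simp: closed_segment_eq_real_ivl)
next
  case False
  then have "(LBINT u=g z1..g z0. (u - D) / deriv g (inv g u)) = G z0 - G z1"
    using assms by (intro link_substitution_le[where m=m]) (auto simp: closed_segment_eq_real_ivl)
  then show ?thesis by (subst interval_integral_endpoints_reverse) simp
qed

lemma quasi_loglik_gradient:
  fixes g :: "real \<Rightarrow> real" and \<alpha> \<beta> x :: "real ^ 'd"
  assumes mono: "strict_mono g" and diff: "\<And>z. g differentiable (at z)" and m: "0 < m"
    and lower: "\<And>a. (a, \<beta>) \<in> param_ball tbar \<Longrightarrow> m \<le> deriv g (x \<bullet> a + x \<bullet> \<beta> * p)"
    and \<alpha>: "(\<alpha>, \<beta>) \<in> param_ball tbar"
  shows "(quasi_loglik g \<beta> x p D has_derivative (\<lambda>v. ((D - g (x \<bullet> \<alpha> + x \<bullet> \<beta> * p)) *\<^sub>R x) \<bullet> v))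
           (at \<alpha> within {a. (a, \<beta>) \<in> param_ball tbar})"
proof -
  define S where "S = {a. (a, \<beta>) \<in> param_ball tbar}"
  let ?z = "\<lambda>a. x \<bullet> a + x \<bullet> \<beta> * p"
  have contg: "continuous_on UNIV g"
    using diff by (simp add: continuous_on_eq_continuous_at differentiable_imp_continuous_within)
  have "\<exists>F. \<forall>z. - \<infinity> < ereal z \<longrightarrow> ereal z < \<infinity> \<longrightarrow> (F has_vector_derivative g z - D) (at z)"
    by (rule einterval_antiderivative)
       (use contg in \<open>auto intro!: continuous_intros simp: continuous_on_eq_continuous_at\<close>)
  then obtain G where "\<And>z. (G has_vector_derivative (g z - D)) (at z)"
    by auto
  then have G: "\<And>z. (G has_real_derivative (g z - D)) (at z)"
    by (simp add: has_real_derivative_iff_has_vector_derivative)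
  have eq: "quasi_loglik g \<beta> x p D a = G (x \<bullet> \<beta> * p) - G (?z a)" if "a \<in> S" for a
  proof -
    have "(LBINT u=g (x \<bullet> \<beta> * p)..g (?z a). (u - D) / deriv g (inv g u)) = G (?z a) - G (x \<bullet> \<beta> * p)"
    proof (rule link_substitution[OF mono diff G m])
      fix z assume "z \<in> closed_segment (x \<bullet> \<beta> * p) (?z a)"
      then obtain s where s: "0 \<le> s" "s \<le> 1" "z = (1 - s) * (x \<bullet> \<beta> * p) + s * ?z a"
        by (auto simp: closed_segment_def)
      have "norm (s *\<^sub>R a, \<beta>) \<le> norm (a, \<beta>)"
        unfolding norm_Pair using s by (auto intro!: power_mono mult_left_le_one_le)
      then have "(s *\<^sub>R a, \<beta>) \<in> param_ball tbar" using that by (simp add: S_def param_ball_def)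
      moreover have "z = ?z (s *\<^sub>R a)" by (simp add: s(3) algebra_simps)
      ultimately show "m \<le> deriv g z" using lower by blast
    qed
    then show ?thesis by (simp add: quasi_loglik_def)
  qed
  have G': "(G has_derivative (\<lambda>h. h * (g (?z \<alpha>) - D))) (at (?z \<alpha>))"
    using G[of "?z \<alpha>"] by (simp add: has_field_derivative_def mult.commute[of _ "g _ - D"])
  have z': "(?z has_derivative (\<lambda>v. x \<bullet> v)) (at \<alpha> within S)"
    by (auto intro!: derivative_eq_intros)
  have "((\<lambda>a. G (x \<bullet> \<beta> * p) - G (?z a)) has_derivative (\<lambda>v. 0 - (x \<bullet> v) * (g (?z \<alpha>) - D))) (at \<alpha> within S)"
    by (intro has_derivative_diff has_derivative_const has_derivative_compose[OF z' G'])
  also have "(\<lambda>v. 0 - (x \<bullet> v) * (g (?z \<alpha>) - D)) = (\<lambda>v. ((D - g (?z \<alpha>)) *\<^sub>R x) \<bullet> v)"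
    by (auto simp: algebra_simps)
  finally have "(quasi_loglik g \<beta> x p D has_derivative (\<lambda>v. ((D - g (?z \<alpha>)) *\<^sub>R x) \<bullet> v)) (at \<alpha> within S)"
    by (rule has_derivative_transform[rotated 2]) (use \<alpha> eq in \<open>auto simp: S_def\<close>)
  then show ?thesis by (simp add: S_def)
qed

definition regret ::
  "'w measure \<Rightarrow> (real \<Rightarrow> real) \<Rightarrow> real ^ 'd \<Rightarrow> real ^ 'd \<Rightarrow> real \<Rightarrow> real \<Rightarrow> nat \<Rightarrow>
    (nat \<Rightarrow> real ^ 'd) \<Rightarrow> (nat \<Rightarrow> 'w \<Rightarrow> real) \<Rightarrow> (nat \<Rightarrow> 'w \<Rightarrow> real) \<Rightarrow> real" where
  "regret M g \<alpha> \<beta> plo phi T x p \<epsilon> =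
     (\<Sum>t=1..T. opt_revenue g plo phi (x t \<bullet> \<alpha>) (x t \<bullet> \<beta>))
     - prob_space.expectation M (\<lambda>\<omega>. \<Sum>t=1..T. p t \<omega> * demand g \<alpha> \<beta> x p \<epsilon> t \<omega>)"

text \<open>A run of certainty-equivalent pricing with regularisation parameter \<open>lam\<close>.\<close>

definition certainty_equivalent_run ::
  "'w measure \<Rightarrow> (real \<Rightarrow> real) \<Rightarrow> real ^ 'd \<Rightarrow> real ^ 'd \<Rightarrow> real \<Rightarrow> real \<Rightarrow> real \<Rightarrow>
    ((real ^ 'd) \<times> (real ^ 'd) \<Rightarrow> real ^ 'd \<Rightarrow> real) \<Rightarrow> nat \<Rightarrow> (nat \<Rightarrow> real ^ 'd) \<Rightarrow>
    (nat \<Rightarrow> 'w \<Rightarrow> real) \<Rightarrow> (nat \<Rightarrow> 'w \<Rightarrow> real) \<Rightarrow> (nat \<Rightarrow> 'w \<Rightarrow> real ^ 'd) \<Rightarrow> bool" where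
  "certainty_equivalent_run M g \<alpha> \<beta> tbar glo lam pstar T x p \<epsilon> \<alpha>hat \<longleftrightarrow>
    (\<forall>\<omega>\<in>space M. \<forall>t\<in>{1..T}.
      is_arg_max
        (\<lambda>a. - (lam * glo / 2) * (norm a)\<^sup>2
             + (\<Sum>s=1..t-1. quasi_loglik g \<beta> (x s) (p s \<omega>) (demand g \<alpha> \<beta> x p \<epsilon> s \<omega>) a))
        (\<lambda>a. (a, \<beta>) \<in> param_ball tbar)
        (\<alpha>hat (t-1) \<omega>) \<and>
      p t \<omega> = pstar (\<alpha>hat (t-1) \<omega>, \<beta>) (x t))"

definition conf_radius :: "real \<Rightarrow> real \<Rightarrow> real \<Rightarrow> nat \<Rightarrow> nat \<Rightarrow> real" where
  "conf_radius tbar sigmabar glo d T =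
     2 * tbar + 2 * sigmabar / glo * sqrt (2 * ln (real T) + real d * ln ((real d + real T) / real d))"

definition regret_bound ::
  "real \<Rightarrow> real \<Rightarrow> real \<Rightarrow> real \<Rightarrow> real \<Rightarrow> real \<Rightarrow> nat \<Rightarrow> nat \<Rightarrow> real" where
  "regret_bound C tbar sigmabar glo phi Dbar d T =
     2 * C * (conf_radius tbar sigmabar glo d T)\<^sup>2 * real d * ln ((real d + real T) / real d)
     + phi * Dbar"

definition soft_bigo :: "'a filter \<Rightarrow> ('a \<Rightarrow> real) \<Rightarrow> ('a \<Rightarrow> real) set" where
  "soft_bigo F f = {h. \<exists>k::nat. h \<in> O[F](\<lambda>z. f z * (ln (f z)) ^ k)}"

text \<open>\<open>T \<rightarrow> \<infinity>\<close>, uniformly over all dimensions \<open>d \<ge> 1\<close>.\<close>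

definition large_horizon :: "(nat \<times> nat) filter" where
  "large_horizon = principal {1..} \<times>\<^sub>F at_top"

end

theory Submission
  imports Defs
begin

text \<open>
  The covariates are deterministic, so the Gram matrices \<open>V\<^sub>t = I + x\<^sub>1x\<^sub>1\<^sup>T + \<dots> + x\<^sub>tx\<^sub>t\<^sup>T\<close> are deterministic
  too, and the expected regret needs only a second moment bound for the estimation error instead of
  a uniform confidence ellipsoid. The first-order condition at the estimate \<open>a\<close> and the strong
  monotonicity of \<open>g\<close> give \<open>\<parallel>\<alpha> - a\<parallel>\<^sub>V \<le> tbar + \<parallel>S\<parallel> / glo\<close>, where \<open>S = \<Sum> \<epsilon>\<^sub>s x\<^sub>s\<close> is measured in the norm
  of \<open>V\<inverse>\<close>. The shocks are orthogonal with second moment at most \<open>2 sigmabar\<^sup>2\<close>, so the expectation of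
  \<open>\<parallel>S\<parallel>\<^sup>2\<close> is at most \<open>2 sigmabar\<^sup>2 \<Sum> x\<^sub>s \<bullet> V\<inverse> x\<^sub>s\<close>. This sum and the sum of the leverages
  \<open>x\<^sub>t \<bullet> V\<^sub>t\<^sub>-\<^sub>1\<inverse> x\<^sub>t\<close>, which weight the squared errors in the regret, are both controlled by
  \<open>ln (det V\<^sub>T) = \<Sum> ln (1 + x\<^sub>t \<bullet> V\<^sub>t\<^sub>-\<^sub>1\<inverse> x\<^sub>t)\<close>, hence by \<open>d ln ((d + T) / d)\<close> through the inequalities of
  Hadamard and of the arithmetic and geometric means.
\<close>

subsection \<open>Determinants of positive definite matrices\<close>

definition outer :: "real ^ 'n \<Rightarrow> real ^ 'n \<Rightarrow> real ^ 'n ^ 'n" where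
  "outer u v = (\<chi> i j. u $ i * v $ j)"

definition posdef :: "real ^ 'n ^ 'n \<Rightarrow> bool" where
  "posdef A \<longleftrightarrow> transpose A = A \<and> (\<forall>v. v \<noteq> 0 \<longrightarrow> 0 < v \<bullet> (A *v v))"

lemma outer_mult_vec [simp]: "outer u v *v w = (v \<bullet> w) *\<^sub>R u"
  by (vector outer_def matrix_vector_mult_def inner_vec_def sum_distrib_right sum_distrib_left mult_ac)

lemma matrix_mult_outer: "A ** outer u v = outer (A *v u) v"
  by (simp add: vec_eq_iff outer_def matrix_matrix_mult_def matrix_vector_mult_def sum_distrib_right
      mult.assoc)

lemma outer_matrix_mult: "outer u v ** A = outer u (v v* A)"
  by (simp add: vec_eq_iff outer_def matrix_matrix_mult_def vector_matrix_mult_def sum_distrib_left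
      mult_ac)

lemma matrix_add_rdistrib: "(A + B) ** C = A ** C + B ** (C :: real ^ 'n ^ 'm)"
  by (simp add: vec_eq_iff matrix_matrix_mult_def sum.distrib distrib_right)

lemma transpose_outer [simp]: "transpose (outer u v) = outer v u"
  by (simp add: outer_def transpose_def mult.commute)

lemma inner_symmetric_matrix:
  fixes A :: "real ^ 'n ^ 'n"
  assumes "transpose A = A"
  shows "u \<bullet> (A *v v) = (A *v u) \<bullet> v"
  by (metis assms dot_lmul_matrix vector_transpose_matrix)

text \<open>Puts a vector into the shape of a combination of rows of the identity, which
  \<open>cramer_lemma_transpose\<close> expects in the next lemma.\<close>

lemma basis_expansion_row: "(\<Sum>i\<in>UNIV. y $ i *s row i (mat 1)) = (y :: real ^ 'n)"
proof -
  have "row i (mat 1) = (axis i 1 :: real ^ 'n)" for i :: 'n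
    by (auto simp: row_def mat_def axis_def vec_eq_iff)
  then show ?thesis by (simp add: basis_expansion)
qed

text \<open>Only row \<open>k\<close> differs from the identity, and it equals the vector
  \<open>?y\<close> below. Cramer's rule for rows reads the determinant off as the
  \<open>k\<close>-th entry of that vector.\<close>

lemma det_one_plus_axis_outer:
  fixes v :: "real ^ 'n"
  shows "det (mat 1 + outer (axis k c) v) = 1 + c * v $ k"
proof -
  let ?y = "axis k 1 + c *\<^sub>R v :: real ^ 'n"
  have "mat 1 + outer (axis k c) v
      = (\<chi> i. if i = k then (\<Sum>i\<in>UNIV. ?y $ i *s row i (mat 1)) else row i (mat 1))"
    by (subst basis_expansion_row) (auto simp: vec_eq_iff outer_def mat_def axis_def row_def)
  then show ?thesis
    using cramer_lemma_transpose[of k ?y "mat 1"] by (simp add: axis_def)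
qed

text \<open>Rotating \<open>u\<close> onto a coordinate axis leaves a single row that differs from the identity.\<close>

lemma det_one_plus_outer:
  fixes u v :: "real ^ 'n"
  shows "det (mat 1 + outer u v) = 1 + u \<bullet> v"
proof -
  obtain k :: 'n where True by blast
  obtain f where f: "orthogonal_transformation f" "f u = axis k (norm u)"
    using orthogonal_transformation_exists[of u "axis k (norm u)"]
    by (auto simp: norm_eq_sqrt_inner inner_axis_axis)
  define R where "R = matrix f"
  have R: "orthogonal_matrix R" and Rf: "R *v w = f w" for w
    using f(1) by (simp_all add: R_def orthogonal_transformation_matrix matrix_works
        orthogonal_transformation_linear)
  have RT: "R ** transpose R = mat 1" "transpose R ** R = mat 1"
    using R by (auto simp: orthogonal_matrix_def)
  have "R ** (mat 1 + outer u v) ** transpose R = mat 1 + outer (f u) (f v)"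
    by (simp add: matrix_add_ldistrib matrix_add_rdistrib RT matrix_mult_outer outer_matrix_mult Rf)
  then have "det (mat 1 + outer (f u) (f v)) = det (R ** transpose R) * det (mat 1 + outer u v)"
    by (metis (no_types, lifting) det_mul mult.assoc mult.commute)
  then have "det (mat 1 + outer u v) = det (mat 1 + outer (f u) (f v))"
    by (simp add: RT)
  also have "\<dots> = 1 + f u \<bullet> f v"
    by (simp add: f(2) det_one_plus_axis_outer inner_axis' )
  also have "f u \<bullet> f v = u \<bullet> v"
    using f(1) by (simp add: orthogonal_transformation_def)
  finally show ?thesis .
qed

text \<open>Factoring out \<open>A\<close> on the left leaves a rank-one perturbation of the
  identity. Naming a preimage \<open>w\<close> of \<open>u\<close> keeps the inverse out of the
  statement.\<close>

lemma det_rank_one_update: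
  fixes A :: "real ^ 'n ^ 'n"
  assumes "A *v w = u"
  shows "det (A + outer u v) = det A * (1 + w \<bullet> v)"
proof -
  have "A + outer u v = A ** (mat 1 + outer w v)"
    by (simp add: matrix_add_ldistrib matrix_mult_outer assms)
  then show ?thesis by (simp add: det_mul det_one_plus_outer)
qed

section \<open>Positive definite forms and their inverses\<close>

lemma posdef_nonneg: "posdef A \<Longrightarrow> 0 \<le> v \<bullet> (A *v v)"
  by (cases "v = 0") (auto simp: posdef_def less_imp_le)

text \<open>The form is nonnegative at u - (b / c) v, its minimiser along the direction of v, where
  its value is a - b^2 / c.\<close>

lemma posdef_Cauchy_Schwarz:
  assumes A: "posdef A"
  shows "(u \<bullet> (A *v v))\<^sup>2 \<le> (u \<bullet> (A *v u)) * (v \<bullet> (A *v v))"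
proof (cases "v = 0")
  case False
  define a b c where "a = u \<bullet> (A *v u)" and "b = u \<bullet> (A *v v)" and "c = v \<bullet> (A *v v)"
  have c: "c > 0" using A False by (simp add: posdef_def c_def)
  have sym: "v \<bullet> (A *v u) = b"
    using A inner_symmetric_matrix[of A v u] by (simp add: posdef_def b_def inner_commute)
  have "0 \<le> (u - (b / c) *\<^sub>R v) \<bullet> (A *v (u - (b / c) *\<^sub>R v))"
    using A by (rule posdef_nonneg)
  also have "\<dots> = a - 2 * (b / c) * b + (b / c)\<^sup>2 * c"
    by (simp add: matrix_vector_mult_diff_distrib matrix_vector_mult_scaleR inner_diff_left
        inner_diff_right sym flip: a_def b_def c_def) (simp add: power2_eq_square algebra_simps)
  also have "\<dots> = a - b\<^sup>2 / c"
    using c by (simp add: field_simps power2_eq_square)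
  finally show ?thesis
    using c by (simp add: field_simps a_def b_def c_def)
qed simp

lemma posdef_invertible:
  fixes A :: "real ^ 'n ^ 'n"
  assumes "posdef A"
  shows "invertible A"
proof -
  have "\<forall>v. A *v v = 0 \<longrightarrow> v = 0"
    using assms unfolding posdef_def by (metis inner_zero_right less_irrefl)
  then show ?thesis
    using invertible_left_inverse matrix_left_invertible_ker by blast
qed

lemma posdef_solution: "posdef A \<Longrightarrow> A *v (matrix_inv A *v u) = u"
  using posdef_invertible[of A] someI_ex[of "\<lambda>B. A ** B = mat 1 \<and> B ** A = mat 1"]
  by (simp add: matrix_vector_mul_assoc matrix_inv_def invertible_def)

text \<open>The norms of \<open>A\<close> and of its inverse are dual: this is Cauchy-Schwarz for
  \<open>A\<close> at \<open>matrix_inv A *v u\<close> and \<open>v\<close>. It later splits the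
  prediction error into leverage and estimation error, and separates the noise from the estimation
  error.\<close>

lemma inner_sq_le_dual:
  assumes A: "posdef A"
  shows "(u \<bullet> v)\<^sup>2 \<le> (u \<bullet> (matrix_inv A *v u)) * (v \<bullet> (A *v v))"
proof -
  let ?w = "matrix_inv A *v u"
  have w: "A *v ?w = u" using A by (rule posdef_solution)
  have "?w \<bullet> (A *v v) = u \<bullet> v"
    using A inner_symmetric_matrix[of A ?w v] w by (simp add: posdef_def)
  then show ?thesis
    using posdef_Cauchy_Schwarz[OF A, of ?w v] by (simp add: w inner_commute)
qed

lemma posdef_add_outer:
  assumes "posdef A"
  shows "posdef (A + outer u u)"
proof -
  have "transpose (A + outer u u) = transpose A + transpose (outer u u)"
    by (simp add: transpose_def vec_eq_iff)
  moreover have "v \<bullet> ((A + outer u u) *v v) = v \<bullet> (A *v v) + (u \<bullet> v)\<^sup>2" for v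
    by (simp add: matrix_vector_mult_add_rdistrib inner_add_right power2_eq_square inner_commute)
  ultimately show ?thesis
    using assms by (simp add: posdef_def add_pos_nonneg)
qed

lemma posdef_one: "posdef (mat 1)"
  by (simp add: posdef_def transpose_mat)

lemma posdef_diagonal_pos:
  assumes "posdef A"
  shows "0 < A $ k $ k"
proof -
  have "0 < axis k 1 \<bullet> (A *v axis k 1)"
    using assms by (simp add: posdef_def axis_eq_0_iff)
  also have "axis k 1 \<bullet> (A *v axis k 1) = A $ k $ k"
    by (simp add: inner_axis' matrix_vector_mult_basis column_def)
  finally show ?thesis .
qed

section \<open>Hadamard's inequality by decoupling one coordinate at a time\<close>

definition decouple :: "'n set \<Rightarrow> real ^ 'n ^ 'n \<Rightarrow> real ^ 'n ^ 'n" where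
  "decouple K A = (\<chi> i j. if i \<noteq> j \<and> (i \<in> K \<or> j \<in> K) then 0 else A $ i $ j)"

text \<open>Let w be v with its \<open>k\<close>-th coordinate cleared. The decoupled form at v is
  the form of \<open>A\<close> at w plus A_kk v_k^2. Both summands are nonnegative, and one is
  positive unless v = 0.\<close>

lemma posdef_decouple_one:
  assumes A: "posdef A"
  shows "posdef (decouple {k} A)"
proof -
  have sym: "A $ i $ j = A $ j $ i" for i j
  proof -
    have "transpose A $ j $ i = A $ j $ i" using A by (simp only: posdef_def)
    then show ?thesis by (simp add: transpose_def)
  qed
  have T: "transpose (decouple {k} A) = decouple {k} A"
    using sym by (auto simp: transpose_def decouple_def vec_eq_iff)
  have "0 < v \<bullet> (decouple {k} A *v v)" if "v \<noteq> 0" for v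
  proof -
    define w :: "real ^ 'a" where "w = (\<chi> i. if i = k then 0 else v $ i)"
    have v: "v = w + axis k (v $ k)"
      by (simp add: vec_eq_iff w_def axis_def)
    have "decouple {k} A *v v = (\<chi> i. if i = k then A $ k $ k * v $ k else (A *v w) $ i)"
      unfolding vec_eq_iff
    proof
      fix i
      show "(decouple {k} A *v v) $ i
          = (\<chi> i. if i = k then A $ k $ k * v $ k else (A *v w) $ i) $ i"
      proof (cases "i = k")
        case True
        then have "(\<Sum>j\<in>UNIV. decouple {k} A $ i $ j * v $ j)
            = (\<Sum>j\<in>UNIV. if j = k then A $ k $ k * v $ k else 0)"
          by (intro sum.cong) (auto simp: decouple_def)
        then show ?thesis using True by (simp add: matrix_vector_mult_def)
      next
        case False
        then show ?thesis
          unfolding matrix_vector_mult_def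
          by (auto simp: decouple_def w_def intro!: sum.cong)
      qed
    qed
    then have "v \<bullet> (decouple {k} A *v v)
        = (\<Sum>i\<in>UNIV. w $ i * (A *v w) $ i + (if i = k then A $ k $ k * (v $ k)\<^sup>2 else 0))"
      unfolding inner_vec_def by (auto simp: w_def power2_eq_square intro!: sum.cong)
    then have eq: "v \<bullet> (decouple {k} A *v v) = w \<bullet> (A *v w) + A $ k $ k * (v $ k)\<^sup>2"
      by (simp add: sum.distrib inner_vec_def)
    show ?thesis
    proof (cases "w = 0")
      case True
      then have "v $ k \<noteq> 0" using that v by (metis add_0 axis_eq_0_iff)
      then show ?thesis using eq True posdef_diagonal_pos[OF A, of k] by simp
    next
      case False
      then have "0 < w \<bullet> (A *v w)" using A by (simp add: posdef_def)
      moreover have "0 \<le> A $ k $ k * (v $ k)\<^sup>2"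
        using posdef_diagonal_pos[OF A, of k] by simp
      ultimately show ?thesis using eq by linarith
    qed
  qed
  then show ?thesis using T by (simp add: posdef_def)
qed

text \<open>The second factor is the numerator of Cramer's rule for entry \<open>k\<close> of the
  solution of A w = e_k. The Leibniz expansions agree term by term: a permutation fixing
  \<open>k\<close> gives equal products up to A_kk, any other gives zero on both sides.\<close>

lemma det_decouple_one:
  "det (decouple {k} A) = A $ k $ k * det (\<chi> i j. if j = k then axis k 1 $ i else A $ i $ j)"
  unfolding det_def sum_distrib_left
proof (rule sum.cong[OF refl])
  fix p :: "'a \<Rightarrow> 'a" assume "p \<in> {p. p permutes UNIV}"
  then have p: "p permutes UNIV" by simp
  let ?B = "\<chi> i j. if j = k then axis k 1 $ i else A $ i $ j"
  have "(\<Prod>i\<in>UNIV. decouple {k} A $ i $ p i) = A $ k $ k * (\<Prod>i\<in>UNIV. ?B $ i $ p i)"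
  proof (cases "p k = k")
    case True
    then have ne: "i \<noteq> k \<Longrightarrow> p i \<noteq> k" for i using p by (metis permutes_inj injD)
    have "(\<Prod>i\<in>UNIV - {k}. decouple {k} A $ i $ p i) = (\<Prod>i\<in>UNIV - {k}. ?B $ i $ p i)"
      by (intro prod.cong) (use ne in \<open>auto simp: decouple_def\<close>)
    then show ?thesis
      using True by (simp add: prod.remove[of UNIV k] decouple_def)
  next
    case False
    obtain i where i: "p i = k" using p by (metis permutes_def)
    have "(\<Prod>i\<in>UNIV. decouple {k} A $ i $ p i) = 0"
      using False by (intro prod_zero bexI[of _ k]) (auto simp: decouple_def)
    moreover have "(\<Prod>i\<in>UNIV. ?B $ i $ p i) = 0"
      using False i by (intro prod_zero bexI[of _ i]) (auto simp: axis_def)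
    ultimately show ?thesis by (simp only: mult_zero_right)
  qed
  then show "of_int (sign p) * (\<Prod>i\<in>UNIV. decouple {k} A $ i $ p i)
      = A $ k $ k * (of_int (sign p) * (\<Prod>i\<in>UNIV. ?B $ i $ p i))" by simp
qed

text \<open>By Cramer's rule this is \<open>1 \<le> A\<^sub>k\<^sub>k (A\<inverse>)\<^sub>k\<^sub>k\<close>, a case of Cauchy--Schwarz.\<close>

lemma det_le_det_decouple_one:
  fixes A :: "real ^ 'n ^ 'n"
  assumes A: "posdef A" and pos: "0 < det A"
  shows "det A \<le> det (decouple {k} A)"
proof -
  let ?e = "axis k 1 :: real ^ 'n"
  let ?w = "matrix_inv A *v ?e"
  have w: "A *v ?w = ?e" using A by (rule posdef_solution)
  then have "?w = (\<chi> k'. det (\<chi> i j. if j = k' then ?e $ i else A $ i $ j) / det A)"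
    using cramer[of A ?w ?e] pos by simp
  then have "?w $ k = (\<chi> k'. det (\<chi> i j. if j = k' then ?e $ i else A $ i $ j) / det A) $ k"
    by (rule arg_cong)
  then have wk: "?w $ k = det (\<chi> i j. if j = k then ?e $ i else A $ i $ j) / det A"
    by (simp only: vec_lambda_beta)
  have "(?e \<bullet> ?e)\<^sup>2 \<le> (?e \<bullet> ?w) * (?e \<bullet> (A *v ?e))"
    using A by (rule inner_sq_le_dual)
  then have "1 \<le> ?w $ k * A $ k $ k"
    by (simp add: inner_axis' matrix_vector_mult_basis column_def)
  then have "1 \<le> det (decouple {k} A) / det A"
    by (simp add: wk det_decouple_one mult.commute)
  then show ?thesis using pos by (simp add: field_simps)
qed

lemma decouple_insert: "decouple (insert k K) A = decouple {k} (decouple K A)"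
  by (auto simp: decouple_def vec_eq_iff)

lemma Hadamard_inequality:
  assumes A: "posdef A" and pos: "0 < det A"
  shows "det A \<le> (\<Prod>i\<in>UNIV. A $ i $ i)"
proof -
  \<comment> \<open>Induction from \<open>{}\<close>, where nothing changes, to \<open>UNIV\<close>,
    where only the diagonal is left. The lower bound by \<open>det A\<close> also keeps the
    determinant positive, as the next decoupling requires.\<close>
  have "posdef (decouple K A) \<and> det A \<le> det (decouple K A)" for K
    using finite[of K]
  proof (induction K rule: finite_induct)
    case empty
    have "decouple {} A = A" by (simp add: decouple_def vec_eq_iff)
    then show ?case using A by simp
  next
    case (insert k K)
    then have "det (decouple K A) \<le> det (decouple {k} (decouple K A))"
      using pos by (intro det_le_det_decouple_one) auto
    then show ?case
      using insert by (auto simp: decouple_insert[of k K] intro: posdef_decouple_one)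
  qed
  then have "det A \<le> det (decouple UNIV A)" by blast
  also have "\<dots> = (\<Prod>i\<in>UNIV. A $ i $ i)"
    by (subst det_diagonal) (auto simp: decouple_def)
  finally show ?thesis .
qed

text \<open>Hadamard's inequality passes to the product of the diagonal entries, and the
  arithmetic-geometric mean inequality to their average.\<close>

lemma ln_det_le:
  fixes A :: "real ^ 'n ^ 'n"
  assumes A: "posdef A" and pos: "0 < det A"
  shows "ln (det A) \<le> real CARD('n) * ln (trace A / real CARD('n))"
proof -
  let ?n = "real CARD('n)"
  have P: "0 < (\<Prod>i\<in>UNIV. A $ i $ i)"
    by (intro prod_pos) (use posdef_diagonal_pos[OF A] in auto)
  have "(\<Prod>i\<in>UNIV. A $ i $ i) powr (1 / ?n) \<le> (\<Sum>i\<in>UNIV. A $ i $ i / ?n)"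
    using posdef_diagonal_pos[OF A] by (intro arith_geom_mean) (auto intro: less_imp_le)
  also have "\<dots> = trace A / ?n"
    by (simp add: trace_def sum_divide_distrib)
  finally have le: "(\<Prod>i\<in>UNIV. A $ i $ i) powr (1 / ?n) \<le> trace A / ?n" .
  have "0 < (\<Prod>i\<in>UNIV. A $ i $ i) powr (1 / ?n)"
    using P by (metis less_irrefl powr_gt_zero)
  then have "ln ((\<Prod>i\<in>UNIV. A $ i $ i) powr (1 / ?n)) \<le> ln (trace A / ?n)"
    using le by (intro ln_mono)
  then have "ln (\<Prod>i\<in>UNIV. A $ i $ i) \<le> ?n * ln (trace A / ?n)"
    using P by (simp add: ln_powr field_simps)
  moreover have "ln (det A) \<le> ln (\<Prod>i\<in>UNIV. A $ i $ i)"
    using Hadamard_inequality[OF A pos] pos by (intro ln_mono) auto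
  ultimately show ?thesis by simp
qed

subsection \<open>Elliptical potential\<close>

text \<open>The initial identity is the contribution of the regulariser at parameter 1. The weight
  \<open>glo\<close>, common to regulariser and curvature, is divided out in
  \<open>estimation_error\<close>.\<close>

primrec gram :: "(nat \<Rightarrow> real ^ 'n) \<Rightarrow> nat \<Rightarrow> real ^ 'n ^ 'n" where
  "gram x 0 = mat 1"
| "gram x (Suc t) = gram x t + outer (x (Suc t)) (x (Suc t))"

definition leverage :: "(nat \<Rightarrow> real ^ 'n) \<Rightarrow> nat \<Rightarrow> real" where
  "leverage x t = x t \<bullet> (matrix_inv (gram x (t - 1)) *v x t)"

lemma posdef_gram: "posdef (gram x t)"
  by (induction t) (simp_all add: posdef_one posdef_add_outer)

lemma gram_quadratic_form: "v \<bullet> (gram x t *v v) = v \<bullet> v + (\<Sum>s=1..t. (x s \<bullet> v)\<^sup>2)"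
  by (induction t)
     (simp_all add: matrix_vector_mult_add_rdistrib inner_add_right power2_eq_square inner_commute)

lemma inner_matrix_inv_nonneg:
  assumes "posdef A"
  shows "0 \<le> u \<bullet> (matrix_inv A *v u)"
  using posdef_nonneg[OF assms, of "matrix_inv A *v u"] posdef_solution[OF assms, of u]
  by (simp add: inner_commute)

lemma leverage_nonneg: "0 \<le> leverage x t"
  unfolding leverage_def by (rule inner_matrix_inv_nonneg[OF posdef_gram])

text \<open>Write w for the solution of V w = x and u for the leverage. As V dominates the identity,
  |w|^2 <= u, while u = x . w <= |w|. Hence u^2 <= u.\<close>

lemma leverage_le_1:
  assumes "norm (x t) \<le> 1"
  shows "leverage x t \<le> 1"
proof -
  let ?w = "matrix_inv (gram x (t - 1)) *v x t"
  have w: "gram x (t - 1) *v ?w = x t" by (rule posdef_solution[OF posdef_gram])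
  have "?w \<bullet> ?w \<le> ?w \<bullet> (gram x (t - 1) *v ?w)"
    unfolding gram_quadratic_form by (simp add: sum_nonneg)
  then have le: "(norm ?w)\<^sup>2 \<le> leverage x t"
    unfolding w power2_norm_eq_inner leverage_def by (simp only: inner_commute)
  have "leverage x t \<le> norm (x t) * norm ?w"
    unfolding leverage_def by (rule norm_cauchy_schwarz)
  also have "\<dots> \<le> 1 * norm ?w" using assms by (intro mult_right_mono) auto
  finally have "leverage x t \<le> norm ?w" by simp
  then have "(leverage x t)\<^sup>2 \<le> leverage x t"
    using le power_mono[OF _ leverage_nonneg, of x t "norm ?w" 2] by linarith
  then show ?thesis
    using leverage_nonneg[of x t] by (cases "leverage x t = 0") (auto simp: power2_eq_square)
qed

text \<open>Each round is a rank-one update, which multiplies the determinant by one plus the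
  leverage.\<close>

lemma det_gram: "det (gram x t) = (\<Prod>s=1..t. 1 + leverage x s)"
proof (induction t)
  case (Suc t)
  have "det (gram x (Suc t)) = det (gram x t) * (1 + leverage x (Suc t))"
    using det_rank_one_update[OF posdef_solution[OF posdef_gram], of x t "x (Suc t)" "x (Suc t)"]
    by (simp add: leverage_def inner_commute)
  then show ?case using Suc by simp
qed simp

lemma trace_gram_le:
  fixes x :: "nat \<Rightarrow> real ^ 'n"
  assumes "\<And>s. s \<in> {1..t} \<Longrightarrow> norm (x s) \<le> 1"
  shows "trace (gram x t) \<le> real CARD('n) + real t"
  using assms
proof (induction t)
  case (Suc t)
  have "trace (outer (x (Suc t)) (x (Suc t))) = (norm (x (Suc t)))\<^sup>2"
    by (simp add: trace_def outer_def power2_norm_eq_inner inner_vec_def)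
  also have "\<dots> \<le> 1"
    using Suc.prems[of "Suc t"] by (simp add: power_le_one)
  finally show ?case using Suc by (simp add: trace_add)
qed (simp add: trace_I)

lemma sum_ln_leverage_le:
  fixes x :: "nat \<Rightarrow> real ^ 'n"
  assumes "\<And>s. s \<in> {1..t} \<Longrightarrow> norm (x s) \<le> 1"
  shows "(\<Sum>s=1..t. ln (1 + leverage x s))
    \<le> real CARD('n) * ln ((real CARD('n) + real t) / real CARD('n))"
proof -
  have pos: "0 < 1 + leverage x s" for s using leverage_nonneg[of x s] by simp
  have det: "0 < det (gram x t)" unfolding det_gram by (intro prod_pos) (simp add: pos)
  have tr: "0 < trace (gram x t)"
    unfolding trace_def by (intro sum_pos) (auto simp: posdef_diagonal_pos[OF posdef_gram])
  have "(\<Sum>s=1..t. ln (1 + leverage x s)) = ln (det (gram x t))"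
    unfolding det_gram using pos by (subst ln_prod) (auto simp: less_imp_neq[OF pos, symmetric])
  also have "\<dots> \<le> real CARD('n) * ln (trace (gram x t) / real CARD('n))"
    by (rule ln_det_le[OF posdef_gram det])
  also have "\<dots> \<le> real CARD('n) * ln ((real CARD('n) + real t) / real CARD('n))"
    using trace_gram_le[of t x] assms tr
    by (intro mult_left_mono ln_mono divide_right_mono) auto
  finally show ?thesis .
qed

lemma div_one_plus_le_ln:
  fixes u :: real
  assumes "0 \<le> u"
  shows "u / (1 + u) \<le> ln (1 + u)"
proof -
  have "ln (1 / (1 + u)) \<le> 1 / (1 + u) - 1"
    using assms by (intro ln_le_minus_one) auto
  moreover have "1 / (1 + u) - 1 = - (u / (1 + u))"
    using assms by (simp add: field_simps)
  ultimately show ?thesis using assms by (simp add: ln_div)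
qed

lemma sum_leverage_le:
  fixes x :: "nat \<Rightarrow> real ^ 'n"
  assumes x: "\<And>s. s \<in> {1..t} \<Longrightarrow> norm (x s) \<le> 1"
  shows "(\<Sum>s=1..t. leverage x s)
    \<le> 2 * (real CARD('n) * ln ((real CARD('n) + real t) / real CARD('n)))"
proof -
  have "leverage x s \<le> 2 * ln (1 + leverage x s)" if "s \<in> {1..t}" for s
  proof -
    \<comment> \<open>The factor 2 in the regret bound originates here: the denominator is at most
      2.\<close>
    have "leverage x s / 2 \<le> leverage x s / (1 + leverage x s)"
      using leverage_nonneg[of x s] leverage_le_1[of x s] x[OF that] by (intro divide_left_mono) auto
    also have "\<dots> \<le> ln (1 + leverage x s)" by (rule div_one_plus_le_ln[OF leverage_nonneg])
    finally show ?thesis by simp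
  qed
  then have "(\<Sum>s=1..t. leverage x s) \<le> (\<Sum>s=1..t. 2 * ln (1 + leverage x s))"
    by (rule sum_mono)
  also have "\<dots> = 2 * (\<Sum>s=1..t. ln (1 + leverage x s))" by (simp add: sum_distrib_left)
  finally show ?thesis using sum_ln_leverage_le[of t x, OF x] by simp
qed

text \<open>Here \<open>x s\<close> is weighted by a matrix that already contains round
  \<open>s\<close>. With y for the left-hand side and u for the leverage, dual Cauchy-Schwarz gives
  y^2 <= u (y - y^2), so y <= u / (1 + u).\<close>

lemma final_leverage_le_ln:
  assumes s: "s \<in> {1..t}"
  shows "x s \<bullet> (matrix_inv (gram x t) *v x s) \<le> ln (1 + leverage x s)"
proof -
  let ?w = "matrix_inv (gram x t) *v x s"
  define y u where "y = x s \<bullet> ?w" and "u = leverage x s"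
  have u: "0 \<le> u" by (simp add: u_def leverage_nonneg)
  have not_mem: "s \<notin> {1..s - 1}" using s by auto
  have "y = ?w \<bullet> (gram x t *v ?w)"
    by (simp add: posdef_solution[OF posdef_gram] y_def inner_commute)
  also have "\<dots> = ?w \<bullet> ?w + (\<Sum>r=1..t. (x r \<bullet> ?w)\<^sup>2)" by (rule gram_quadratic_form)
  \<comment> \<open>Rounds after \<open>s\<close> are dropped; the term of round \<open>s\<close>
    itself is y^2.\<close>
  also have "\<dots> \<ge> ?w \<bullet> ?w + (\<Sum>r\<in>insert s {1..s-1}. (x r \<bullet> ?w)\<^sup>2)"
    using s by (intro add_left_mono sum_mono2) auto
  finally have "?w \<bullet> (gram x (s - 1) *v ?w) + y\<^sup>2 \<le> y"
    unfolding gram_quadratic_form using not_mem by (simp add: y_def ac_simps)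
  moreover have "y\<^sup>2 \<le> u * (?w \<bullet> (gram x (s - 1) *v ?w))"
    unfolding y_def u_def leverage_def by (rule inner_sq_le_dual[OF posdef_gram])
  ultimately have "y\<^sup>2 \<le> u * (y - y\<^sup>2)"
    using u by (meson mult_left_mono order_trans le_diff_eq)
  then have "y * y * (1 + u) \<le> y * u" by (simp add: power2_eq_square algebra_simps)
  have "y \<le> u / (1 + u)"
  proof (cases "y \<le> 0")
    case True
    moreover have "0 \<le> u / (1 + u)" using u by simp
    ultimately show ?thesis by linarith
  next
    case False
    have "y * (y * (1 + u)) \<le> y * u"
      using \<open>y * y * (1 + u) \<le> y * u\<close> by (simp only: mult.assoc)
    then have "y * (1 + u) \<le> u" using False by simp
    then show ?thesis using u by (simp add: pos_le_divide_eq)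
  qed
  also have "\<dots> \<le> ln (1 + u)" by (rule div_one_plus_le_ln[OF u])
  finally show ?thesis by (simp add: y_def u_def)
qed

subsection \<open>Error of the regularised quasi-likelihood estimate\<close>

text \<open>First-order condition for a maximiser that may lie on the boundary. A positive
  derivative along the segment towards \<open>b\<close> would make F increase at \<open>a\<close>
  inside \<open>S\<close>.\<close>

lemma maximum_directional_derivative_le:
  fixes F :: "'a::real_normed_vector \<Rightarrow> real"
  assumes F: "(F has_derivative F') (at a within S)" and S: "convex S"
    and a: "a \<in> S" and b: "b \<in> S" and max: "\<And>c. c \<in> S \<Longrightarrow> F c \<le> F a"
  shows "F' (b - a) \<le> 0"
proof (rule ccontr)
  assume "\<not> F' (b - a) \<le> 0"
  then have pos: "0 < F' (b - a)" by simp
  define \<phi> where "\<phi> h = a + h *\<^sub>R (b - a)" for h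
  have sub: "\<phi> ` {0..1} \<subseteq> S"
  proof
    fix c assume "c \<in> \<phi> ` {0..1}"
    then obtain h where "0 \<le> h" "h \<le> 1" "c = (1 - h) *\<^sub>R a + h *\<^sub>R b"
      by (auto simp: \<phi>_def algebra_simps)
    then show "c \<in> S" using S a b by (simp add: convex_alt)
  qed
  have "(\<phi> has_derivative (\<lambda>h. h *\<^sub>R (b - a))) (at 0 within {0..1})"
    unfolding \<phi>_def by (auto intro!: derivative_eq_intros)
  moreover have "(F has_derivative F') (at (\<phi> 0) within \<phi> ` {0..1})"
    using has_derivative_subset[OF F sub] by (simp add: \<phi>_def)
  ultimately have "((\<lambda>h. F (\<phi> h)) has_derivative (\<lambda>h. F' (h *\<^sub>R (b - a)))) (at 0 within {0..1})"
    by (rule has_derivative_in_compose)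
  moreover have "F' (h *\<^sub>R (b - a)) = h * F' (b - a)" for h
    using has_derivative_linear[OF F] by (simp add: linear_cmul)
  ultimately have "((\<lambda>h. F (\<phi> h)) has_real_derivative F' (b - a)) (at 0 within {0..1})"
    by (simp add: has_field_derivative_def mult_commute_abs)
  from has_real_derivative_pos_inc_right[OF this pos]
  obtain d where d: "d > 0" "\<And>h. 0 < h \<Longrightarrow> h \<in> {0..1} \<Longrightarrow> h < d \<Longrightarrow> F (\<phi> 0) < F (\<phi> h)"
    by auto
  define h where "h = min 1 (d / 2)"
  have h: "0 < h" "h \<in> {0..1}" "h < d" using d(1) by (auto simp: h_def)
  then have "F a < F (\<phi> h)" using d(2)[of h] by (simp add: \<phi>_def)
  moreover have "F (\<phi> h) \<le> F a" using sub h by (intro max) auto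
  ultimately show False by simp
qed

text \<open>Mean value theorem. The derivative bound is asked only on the segment because the link
  assumption covers only indices of parameters in the ball.\<close>

lemma strong_monotonicity:
  fixes g :: "real \<Rightarrow> real"
  assumes diff: "\<And>z. g differentiable (at z)"
    and m: "\<And>z. z \<in> closed_segment z0 z1 \<Longrightarrow> m \<le> deriv g z"
  shows "m * (z1 - z0)\<^sup>2 \<le> (g z1 - g z0) * (z1 - z0)"
proof -
  have der: "(g has_real_derivative deriv g z) (at z)" for z
    using diff DERIV_deriv_iff_real_differentiable by blast
  have *: "m * (b - a)\<^sup>2 \<le> (g b - g a) * (b - a)"
    if "a < b" and m: "\<And>z. z \<in> {a..b} \<Longrightarrow> m \<le> deriv g z" for a b
  proof -
    obtain z where z: "a < z" "z < b" "g b - g a = (b - a) * deriv g z"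
      using MVT2[OF \<open>a < b\<close>, of g "deriv g"] der by auto
    have "m * (b - a)\<^sup>2 \<le> deriv g z * (b - a)\<^sup>2"
      using m[of z] z by (intro mult_right_mono) auto
    then show ?thesis using z by (simp add: power2_eq_square mult_ac)
  qed
  show ?thesis
  proof (cases z0 z1 rule: linorder_cases)
    case less
    then show ?thesis using *[of z0 z1] m by (auto simp: closed_segment_eq_real_ivl)
  next
    case greater
    then have "m * (z0 - z1)\<^sup>2 \<le> (g z0 - g z1) * (z0 - z1)"
      using *[of z1 z0] m by (auto simp: closed_segment_eq_real_ivl)
    then show ?thesis by (simp add: power2_eq_square algebra_simps)
  qed simp
qed

lemma convex_param_slice:
  fixes \<beta> :: "real ^ 'd"
  shows "convex {a :: real ^ 'd. (a, \<beta>) \<in> param_ball r}"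
proof (rule convexI)
  fix a b :: "real ^ 'd" and u v :: real
  assume ab: "a \<in> {a. (a, \<beta>) \<in> param_ball r}" "b \<in> {a. (a, \<beta>) \<in> param_ball r}"
    and uv: "0 \<le> u" "0 \<le> v" "u + v = 1"
  have "(u *\<^sub>R a + v *\<^sub>R b, \<beta>) = u *\<^sub>R (a, \<beta>) + v *\<^sub>R (b, \<beta>)"
    using uv by (simp flip: scaleR_left_distrib)
  also have "\<dots> \<in> cball 0 r"
    using ab uv by (intro convexD[OF convex_cball]) (auto simp: param_ball_def)
  finally show "u *\<^sub>R a + v *\<^sub>R b \<in> {a. (a, \<beta>) \<in> param_ball r}" by (simp add: param_ball_def)
qed

text \<open>A pathwise statement: \<open>p\<close> and \<open>e\<close> are the prices and shocks
  along one outcome. The first-order condition at \<open>a\<close>, tested towards the true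
  parameter, is compared with the curvature \<open>glo\<close> of the quasi-likelihood.\<close>

lemma estimation_error:
  fixes x :: "nat \<Rightarrow> real ^ 'd" and \<alpha> \<beta> a :: "real ^ 'd" and p e :: "nat \<Rightarrow> real"
  assumes mono: "strict_mono g" and diff: "\<And>z. g differentiable (at z)" and glo: "0 < glo"
    and lower: "\<And>s b. s \<in> {1..t} \<Longrightarrow> (b, \<beta>) \<in> param_ball tbar \<Longrightarrow>
      glo \<le> deriv g (x s \<bullet> b + x s \<bullet> \<beta> * p s)"
    and \<alpha>: "(\<alpha>, \<beta>) \<in> param_ball tbar"
    and max: "is_arg_max
      (\<lambda>a. - (glo / 2) * (norm a)\<^sup>2
           + (\<Sum>s=1..t. quasi_loglik g \<beta> (x s) (p s) (g (x s \<bullet> \<alpha> + x s \<bullet> \<beta> * p s) + e s) a))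
      (\<lambda>a. (a, \<beta>) \<in> param_ball tbar) a"
  defines "S \<equiv> \<Sum>s=1..t. e s *\<^sub>R x s"
  shows "(\<alpha> - a) \<bullet> (gram x t *v (\<alpha> - a))
    \<le> 2 * tbar\<^sup>2 + 2 / glo\<^sup>2 * (S \<bullet> (matrix_inv (gram x t) *v S))"
proof -
  define B where "B = {a. (a, \<beta>) \<in> param_ball tbar}"
  define z where "z s b = x s \<bullet> b + x s \<bullet> \<beta> * p s" for s b
  define F where "F a = - (glo / 2) * (norm a)\<^sup>2
           + (\<Sum>s=1..t. quasi_loglik g \<beta> (x s) (p s) (g (z s \<alpha>) + e s) a)" for a
  define \<Delta> where "\<Delta> = \<alpha> - a"
  have a: "a \<in> B" and F_le: "\<And>b. b \<in> B \<Longrightarrow> F b \<le> F a"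
    using max by (auto simp: is_arg_max_def B_def F_def z_def not_less)
  have "((\<lambda>a. - (glo / 2) * (a \<bullet> a)) has_derivative (\<lambda>v. - glo * (a \<bullet> v))) (at a within B)"
    by (auto intro!: derivative_eq_intros simp: inner_commute algebra_simps)
  moreover have "((\<lambda>a. \<Sum>s=1..t. quasi_loglik g \<beta> (x s) (p s) (g (z s \<alpha>) + e s) a) has_derivative
      (\<lambda>v. \<Sum>s=1..t. ((g (z s \<alpha>) + e s - g (z s a)) *\<^sub>R x s) \<bullet> v)) (at a within B)"
    unfolding B_def z_def using a lower
    by (intro has_derivative_sum quasi_loglik_gradient[OF mono diff glo]) (auto simp: B_def)
  ultimately have "(F has_derivative (\<lambda>v. - glo * (a \<bullet> v)
      + (\<Sum>s=1..t. ((g (z s \<alpha>) + e s - g (z s a)) *\<^sub>R x s) \<bullet> v))) (at a within B)"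
    unfolding F_def power2_norm_eq_inner by (rule has_derivative_add)
  \<comment> \<open>The estimate may sit on the boundary of the ball, so the score has a sign in the
    direction of the true parameter but need not vanish.\<close>
  from maximum_directional_derivative_le[OF this, of \<alpha>]
  have foc: "- glo * (a \<bullet> \<Delta>) + (\<Sum>s=1..t. ((g (z s \<alpha>) + e s - g (z s a)) *\<^sub>R x s) \<bullet> \<Delta>) \<le> 0"
    using convex_param_slice[of \<beta> tbar] a \<alpha> F_le by (simp add: B_def \<Delta>_def)
  have mon: "glo * (x s \<bullet> \<Delta>)\<^sup>2 \<le> (g (z s \<alpha>) - g (z s a)) * (x s \<bullet> \<Delta>)" if s: "s \<in> {1..t}" for s
  proof -
    have "glo * (z s \<alpha> - z s a)\<^sup>2 \<le> (g (z s \<alpha>) - g (z s a)) * (z s \<alpha> - z s a)"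
    proof (rule strong_monotonicity[OF diff])
      fix y assume "y \<in> closed_segment (z s a) (z s \<alpha>)"
      then obtain u where u: "0 \<le> u" "u \<le> 1" "y = (1 - u) * z s a + u * z s \<alpha>"
        by (auto simp: closed_segment_def)
      have "(1 - u) *\<^sub>R a + u *\<^sub>R \<alpha> \<in> B"
        using convex_param_slice[of \<beta> tbar] a \<alpha> u by (simp add: convex_alt B_def)
      moreover have "y = z s ((1 - u) *\<^sub>R a + u *\<^sub>R \<alpha>)"
        by (simp add: u(3) z_def algebra_simps)
      ultimately show "glo \<le> deriv g y" using lower[OF s] by (simp add: B_def z_def)
    qed
    then show ?thesis by (simp add: z_def \<Delta>_def inner_diff_right)
  qed
  define q N where "q = \<Delta> \<bullet> (gram x t *v \<Delta>)" and "N = S \<bullet> (matrix_inv (gram x t) *v S)"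
  have "glo * q = glo * (\<Delta> \<bullet> \<Delta>) + (\<Sum>s=1..t. glo * (x s \<bullet> \<Delta>)\<^sup>2)"
    by (simp add: q_def gram_quadratic_form distrib_left sum_distrib_left)
  also have "\<dots> \<le> glo * (\<Delta> \<bullet> \<Delta>) + (\<Sum>s=1..t. (g (z s \<alpha>) - g (z s a)) * (x s \<bullet> \<Delta>))"
    by (intro add_left_mono sum_mono mon)
  \<comment> \<open>Adding and subtracting the shocks produces the score from
    \<open>foc\<close>.\<close>
  also have "(\<Sum>s=1..t. (g (z s \<alpha>) - g (z s a)) * (x s \<bullet> \<Delta>))
      = (\<Sum>s=1..t. ((g (z s \<alpha>) + e s - g (z s a)) *\<^sub>R x s) \<bullet> \<Delta>) - S \<bullet> \<Delta>"
    by (simp add: S_def inner_sum_left algebra_simps flip: sum.distrib sum_subtractf)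
  also have "glo * (\<Delta> \<bullet> \<Delta>) + \<dots> \<le> glo * (\<Delta> \<bullet> \<Delta>) + (glo * (a \<bullet> \<Delta>) - S \<bullet> \<Delta>)"
    using foc by simp
  \<comment> \<open>The ridge term from \<open>foc\<close> turns the square of \<Delta> into the
    regularisation bias \<alpha> . \<Delta>.\<close>
  also have "\<dots> = glo * (\<alpha> \<bullet> \<Delta>) - S \<bullet> \<Delta>"
    by (simp add: \<Delta>_def algebra_simps)
  finally have main: "glo * q \<le> glo * (\<alpha> \<bullet> \<Delta>) - S \<bullet> \<Delta>" .
  have \<Delta>q: "(norm \<Delta>)\<^sup>2 \<le> q"
    by (simp add: q_def gram_quadratic_form power2_norm_eq_inner sum_nonneg)
  have N: "0 \<le> N" unfolding N_def by (rule inner_matrix_inv_nonneg[OF posdef_gram])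
  have q0: "0 \<le> q" using \<Delta>q by (rule order_trans[rotated]) simp
  have "norm \<alpha> \<le> norm (\<alpha>, \<beta>)" by (rule norm_fst_le)
  then have tb: "norm \<alpha> \<le> tbar" using \<alpha> by (simp add: param_ball_def)
  have nD: "norm \<Delta> \<le> sqrt q" using \<Delta>q by (simp add: real_le_rsqrt)
  have "\<alpha> \<bullet> \<Delta> \<le> norm \<alpha> * norm \<Delta>" by (rule norm_cauchy_schwarz)
  also have "\<dots> \<le> tbar * sqrt q" using tb nD by (intro mult_mono) (auto intro: order_trans[OF norm_ge_zero])
  finally have 1: "glo * (\<alpha> \<bullet> \<Delta>) \<le> glo * (tbar * sqrt q)" using glo by simp
  have "(S \<bullet> \<Delta>)\<^sup>2 \<le> N * q"
    unfolding N_def q_def by (rule inner_sq_le_dual[OF posdef_gram])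
  then have "\<bar>S \<bullet> \<Delta>\<bar> \<le> sqrt N * sqrt q" by (simp add: real_le_rsqrt flip: real_sqrt_mult)
  then have "glo * q \<le> glo * (tbar * sqrt q) + sqrt N * sqrt q" using main 1 by linarith
  then have "glo * sqrt q * sqrt q \<le> (glo * tbar + sqrt N) * sqrt q"
    using q0 by (simp add: algebra_simps)
  then have "sqrt q \<le> tbar + sqrt N / glo"
  proof (cases "q = 0")
    case True
    moreover have "0 \<le> tbar" using norm_ge_zero tb by (rule order_trans)
    ultimately show ?thesis using glo N by simp
  next
    case False
    then have "glo * sqrt q \<le> glo * tbar + sqrt N"
      using \<open>glo * sqrt q * sqrt q \<le> _\<close> q0 by (simp add: mult_le_cancel_right)
    then show ?thesis using glo by (simp add: field_simps)
  qed
  then have "q \<le> (tbar + sqrt N / glo)\<^sup>2"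
    using q0 by (metis power_mono real_sqrt_ge_zero real_sqrt_pow2)
  \<comment> \<open>Separates bias from noise, leaving a bound linear in \<open>N\<close> that can
    be integrated.\<close>
  also have "\<dots> \<le> 2 * tbar\<^sup>2 + 2 * (sqrt N / glo)\<^sup>2"
    using sum_squares_bound[of tbar "sqrt N / glo"] by (simp add: power2_sum)
  also have "\<dots> = 2 * tbar\<^sup>2 + 2 / glo\<^sup>2 * N"
    using N by (simp add: power_divide)
  finally show ?thesis by (simp add: q_def N_def \<Delta>_def)
qed

subsection \<open>Conditionally centred sub-Gaussian shocks\<close>

text \<open>With h = |y| / 2, the right side minus 2 is (exp h - exp (-h))^2, so it suffices that
  exp h - exp (-h) >= 2 h.\<close>

lemma exp_add_exp_minus_ge:
  fixes y :: real
  shows "2 + y\<^sup>2 \<le> exp y + exp (- y)"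
proof -
  define h where "h = \<bar>y\<bar> / 2"
  define c where "c = 1 + h + h\<^sup>2 / 2"
  have h: "0 \<le> h" by (simp add: h_def)
  have c: "0 < c" "c \<le> exp h" using h exp_lower_Taylor_quadratic[OF h] by (auto simp: c_def add_pos_nonneg)
  have "exp (- h) \<le> 1 / c" using c by (simp add: exp_minus divide_inverse le_imp_inverse_le)
  \<comment> \<open>The quadratic Taylor polynomials at h and -h have product 1 + h^4 / 4 >=
    1.\<close>
  also have "\<dots> \<le> 1 - h + h\<^sup>2 / 2"
  proof -
    have "(1 - h + h\<^sup>2 / 2) * c = 1 + (h\<^sup>2)\<^sup>2 / 4"
      by (simp add: c_def power2_eq_square field_simps)
    then show ?thesis using c by (simp add: pos_divide_le_eq)
  qed
  finally have "2 * h \<le> exp h - exp (- h)" using c by (simp add: c_def)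
  then have "(2 * h)\<^sup>2 \<le> (exp h - exp (- h))\<^sup>2" using h by (intro power_mono) auto
  also have "\<dots> = exp (2 * h) + exp (- (2 * h)) - 2"
    by (simp add: power2_diff flip: exp_double exp_add)
  also have "\<dots> = exp y + exp (- y) - 2" by (simp add: h_def abs_if)
  finally show ?thesis by (simp add: h_def power_mult_distrib)
qed

text \<open>Integrating the previous inequality at s X bounds s^2 E X^2 by 2 exp (\<sigma>^2 s^2 /
  2) - 2. One fixed s gives the bound without a limit.\<close>

lemma (in prob_space) subgaussian_second_moment:
  fixes X :: "'a \<Rightarrow> real" and \<sigma> :: real
  assumes X [measurable]: "X \<in> borel_measurable M"
    and int: "\<And>s. integrable M (\<lambda>\<omega>. exp (s * X \<omega>))"
    and mgf: "\<And>s. expectation (\<lambda>\<omega>. exp (s * X \<omega>)) \<le> exp (\<sigma>\<^sup>2 * s\<^sup>2 / 2)"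
  shows "integrable M (\<lambda>\<omega>. (X \<omega>)\<^sup>2)" and "expectation (\<lambda>\<omega>. (X \<omega>)\<^sup>2) \<le> 2 * \<sigma>\<^sup>2"
proof -
  have ge: "(s * X \<omega>)\<^sup>2 \<le> exp (s * X \<omega>) + exp ((- s) * X \<omega>) - 2" for s \<omega>
    using exp_add_exp_minus_ge[of "s * X \<omega>"] by simp
  show sq: "integrable M (\<lambda>\<omega>. (X \<omega>)\<^sup>2)"
  proof (rule Bochner_Integration.integrable_bound)
    show "integrable M (\<lambda>\<omega>. exp (1 * X \<omega>) + exp ((- 1) * X \<omega>))"
      using int by (intro Bochner_Integration.integrable_add)
    show "AE \<omega> in M. norm ((X \<omega>)\<^sup>2) \<le> norm (exp (1 * X \<omega>) + exp ((- 1) * X \<omega>))"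
      using ge[of 1] by (intro AE_I2) (simp add: algebra_simps abs_of_nonneg add_nonneg_nonneg, smt (verit))
  qed measurable
  have bnd: "s\<^sup>2 * expectation (\<lambda>\<omega>. (X \<omega>)\<^sup>2) \<le> 2 * exp (\<sigma>\<^sup>2 * s\<^sup>2 / 2) - 2" for s
  proof -
    have "s\<^sup>2 * expectation (\<lambda>\<omega>. (X \<omega>)\<^sup>2) = expectation (\<lambda>\<omega>. (s * X \<omega>)\<^sup>2)"
      by (simp add: power_mult_distrib)
    also have "\<dots> \<le> expectation (\<lambda>\<omega>. exp (s * X \<omega>) + exp ((- s) * X \<omega>) - 2)"
    proof (rule integral_mono)
      show "integrable M (\<lambda>\<omega>. (s * X \<omega>)\<^sup>2)" using sq by (simp add: power_mult_distrib)
      show "integrable M (\<lambda>\<omega>. exp (s * X \<omega>) + exp ((- s) * X \<omega>) - 2)"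
        using int[of s] int[of "- s"]
        by (intro Bochner_Integration.integrable_add Bochner_Integration.integrable_diff) auto
    qed (rule ge)
    also have "\<dots> = expectation (\<lambda>\<omega>. exp (s * X \<omega>)) + expectation (\<lambda>\<omega>. exp ((- s) * X \<omega>)) - 2"
      using int[of s] int[of "- s"] by (simp add: prob_space)
    also have "\<dots> \<le> 2 * exp (\<sigma>\<^sup>2 * s\<^sup>2 / 2) - 2"
      using mgf[of s] mgf[of "- s"] by simp
    finally show ?thesis .
  qed
  show "expectation (\<lambda>\<omega>. (X \<omega>)\<^sup>2) \<le> 2 * \<sigma>\<^sup>2"
  proof (cases "\<sigma> = 0")
    case True
    then show ?thesis using bnd[of 1] by simp
  next
    case False
    \<comment> \<open>At s = 1 / \<sigma> the bound is 2 exp (1/2) - 2 <= 2, whence the factor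
      2.\<close>
    have "exp (1 / 2 :: real) \<le> 2" using exp_bound_half[of "1 / 2 :: real"] by simp
    moreover have "(1 / \<sigma>)\<^sup>2 * expectation (\<lambda>\<omega>. (X \<omega>)\<^sup>2) \<le> 2 * exp (1 / 2) - 2"
      using bnd[of "1 / \<sigma>"] False by (simp add: power_divide)
    ultimately have "(1 / \<sigma>)\<^sup>2 * expectation (\<lambda>\<omega>. (X \<omega>)\<^sup>2) \<le> 2" by linarith
    then show ?thesis using False by (simp add: power_divide field_simps)
  qed
qed

text \<open>Strong induction, since \<open>history\<close> at \<open>t\<close> contains the prices
  up to \<open>t\<close>, and the price of round \<open>s\<close> is measurable only through the
  history at \<open>s - 1\<close>.\<close>

lemma subalgebra_history:
  assumes \<epsilon>: "\<And>t. t \<in> {1..T} \<Longrightarrow> \<epsilon> t \<in> borel_measurable M"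
    and p: "\<And>t. t \<in> {1..T} \<Longrightarrow> p t \<in> borel_measurable (history M x p \<epsilon> (t - 1))"
  shows "t \<le> T \<Longrightarrow> subalgebra M (history M x p \<epsilon> t)"
proof (induction t rule: less_induct)
  case (less t)
  have pM: "p s \<in> borel_measurable M" if "s \<in> {1..t}" for s
    using that less.prems by (intro measurable_from_subalg[OF less.IH[of "s - 1"] p]) auto
  have "{p s -` A \<inter> space M | s A. s \<in> {1..t} \<and> A \<in> sets borel} \<union>
      {\<epsilon> s -` A \<inter> space M | s A. s \<in> {1..t} \<and> A \<in> sets borel} \<union>
      {(\<lambda>\<omega>. x s) -` A \<inter> space M | s A. s \<in> {1..Suc t} \<and> A \<in> sets borel} \<subseteq> sets M"
    using less.prems pM by (auto intro!: measurable_sets[where A = borel] \<epsilon>)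
  then show ?case
    unfolding subalgebra_def history_def
    by (simp add: space_measure_of_conv sets.sigma_sets_subset sets_measure_of_conv)
qed

lemma shock_history_measurable:
  assumes "s \<in> {1..t}"
  shows "\<epsilon> s \<in> borel_measurable (history M x p \<epsilon> t)"
proof (rule measurableI)
  fix A :: "real set" assume A: "A \<in> sets borel"
  have sp: "space (history M x p \<epsilon> t) = space M"
    by (simp add: history_def space_measure_of_conv)
  show "\<epsilon> s -` A \<inter> space (history M x p \<epsilon> t) \<in> sets (history M x p \<epsilon> t)"
    unfolding sp unfolding history_def
    by (rule in_measure_of) (use A assms in auto)
qed simp

text \<open>The factor known from the past is pulled out of the conditional expectation. This makes
  distinct shocks orthogonal and removes price times shock from the expected reward.\<close>

lemma (in prob_space) expectation_mult_cond_mean_zero: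
  assumes F: "subalgebra M F" and Y: "Y \<in> borel_measurable F" and X: "X \<in> borel_measurable M"
    and int: "integrable M (\<lambda>\<omega>. Y \<omega> * X \<omega>)"
    and zero: "AE \<omega> in M. real_cond_exp M F X \<omega> = 0"
  shows "expectation (\<lambda>\<omega>. Y \<omega> * X \<omega>) = 0"
proof -
  interpret finite_measure_subalgebra M F by unfold_locales (rule F)
  have "expectation (\<lambda>\<omega>. Y \<omega> * X \<omega>) = expectation (\<lambda>\<omega>. Y \<omega> * real_cond_exp M F X \<omega>)"
    by (rule real_cond_exp_intg(2)[OF int Y X, symmetric])
  also have "\<dots> = expectation (\<lambda>\<omega>. 0)"
    by (rule integral_cong_AE) (use zero measurable_from_subalg[OF F Y] in \<open>auto elim: eventually_mono\<close>)
  finally show ?thesis by simp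
qed

lemma (in prob_space) expectation_le_of_ln_cond_exp_le:
  assumes F: "subalgebra M F" and int: "integrable M X"
    and le: "AE \<omega> in M. ln (real_cond_exp M F X \<omega>) \<le> k"
  shows "expectation X \<le> exp k"
proof -
  interpret finite_measure_subalgebra M F by unfold_locales (rule F)
  \<comment> \<open>For nonpositive \<open>y\<close> the claim follows from positivity of
    \<open>exp\<close>, so the logarithm is inverted only where it is meaningful.\<close>
  have "y \<le> exp k" if "ln y \<le> k" for y :: real
    using that exp_ge_zero[of k] by (cases "0 < y") (metis exp_le_cancel_iff exp_ln, linarith)
  then have "AE \<omega> in M. real_cond_exp M F X \<omega> \<le> exp k"
    using le by (auto elim: eventually_mono)
  then have "expectation (real_cond_exp M F X) \<le> expectation (\<lambda>\<omega>. exp k)"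
    by (intro integral_mono_AE real_cond_exp_int int) auto
  then show ?thesis using real_cond_exp_int(2)[OF int] by (simp add: prob_space)
qed

lemma integrable_mult_of_squares:
  fixes X Y :: "'a \<Rightarrow> real"
  assumes [measurable]: "X \<in> borel_measurable M" "Y \<in> borel_measurable M"
    and sq: "integrable M (\<lambda>\<omega>. (X \<omega>)\<^sup>2)" "integrable M (\<lambda>\<omega>. (Y \<omega>)\<^sup>2)"
  shows "integrable M (\<lambda>\<omega>. X \<omega> * Y \<omega>)"
proof (rule Bochner_Integration.integrable_bound[OF Bochner_Integration.integrable_add[OF sq]])
  show "AE \<omega> in M. norm (X \<omega> * Y \<omega>) \<le> norm ((X \<omega>)\<^sup>2 + (Y \<omega>)\<^sup>2)"
  proof (rule AE_I2)
    fix \<omega>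
    have "0 \<le> \<bar>X \<omega>\<bar> * \<bar>Y \<omega>\<bar>" "2 * \<bar>X \<omega>\<bar> * \<bar>Y \<omega>\<bar> \<le> (X \<omega>)\<^sup>2 + (Y \<omega>)\<^sup>2"
      using sum_squares_bound[of "\<bar>X \<omega>\<bar>" "\<bar>Y \<omega>\<bar>"] by auto
    then have "\<bar>X \<omega>\<bar> * \<bar>Y \<omega>\<bar> \<le> (X \<omega>)\<^sup>2 + (Y \<omega>)\<^sup>2" by linarith
    then show "norm (X \<omega> * Y \<omega>) \<le> norm ((X \<omega>)\<^sup>2 + (Y \<omega>)\<^sup>2)"
      by (simp add: abs_mult)
  qed
qed measurable

text \<open>\<open>W\<close> and the vectors are deterministic, so the expectation passes to the
  products of the \<open>X s\<close>, and orthogonality leaves only the diagonal terms.\<close>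

lemma (in prob_space) expectation_quadratic_form_le:
  fixes X :: "'i \<Rightarrow> 'a \<Rightarrow> real" and x :: "'i \<Rightarrow> real ^ 'd"
  assumes I: "finite I" and X: "\<And>s. s \<in> I \<Longrightarrow> X s \<in> borel_measurable M"
    and sq: "\<And>s. s \<in> I \<Longrightarrow> integrable M (\<lambda>\<omega>. (X s \<omega>)\<^sup>2)"
    and v: "\<And>s. s \<in> I \<Longrightarrow> expectation (\<lambda>\<omega>. (X s \<omega>)\<^sup>2) \<le> v"
    and orth: "\<And>s r. s \<in> I \<Longrightarrow> r \<in> I \<Longrightarrow> s \<noteq> r \<Longrightarrow> expectation (\<lambda>\<omega>. X s \<omega> * X r \<omega>) = 0"
    and W: "\<And>u. 0 \<le> u \<bullet> (W *v u)"
  defines "N \<equiv> \<lambda>\<omega>. (\<Sum>s\<in>I. X s \<omega> *\<^sub>R x s) \<bullet> (W *v (\<Sum>s\<in>I. X s \<omega> *\<^sub>R x s))"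
  shows "integrable M N" and "expectation N \<le> v * (\<Sum>s\<in>I. x s \<bullet> (W *v x s))"
proof -
  have N: "N = (\<lambda>\<omega>. \<Sum>s\<in>I. \<Sum>r\<in>I. (X s \<omega> * X r \<omega>) * (x s \<bullet> (W *v x r)))"
    unfolding N_def linear_sum[OF matrix_vector_mul_linear] inner_sum_left
    by (simp add: inner_sum_right matrix_vector_mult_scaleR mult_ac)
  have int: "integrable M (\<lambda>\<omega>. X s \<omega> * X r \<omega>)" if "s \<in> I" "r \<in> I" for s r
    using that X sq by (intro integrable_mult_of_squares)
  then show "integrable M N"
    unfolding N by (intro Bochner_Integration.integrable_sum integrable_mult_left)
  have "expectation N = (\<Sum>s\<in>I. \<Sum>r\<in>I. expectation (\<lambda>\<omega>. X s \<omega> * X r \<omega>) * (x s \<bullet> (W *v x r)))"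
    unfolding N using int by (simp add: Bochner_Integration.integral_sum)
  also have "\<dots> = (\<Sum>s\<in>I. \<Sum>r\<in>I. if r = s then expectation (\<lambda>\<omega>. (X s \<omega>)\<^sup>2) * (x s \<bullet> (W *v x s)) else 0)"
    using orth by (intro sum.cong refl) (auto simp: power2_eq_square)
  also have "\<dots> = (\<Sum>s\<in>I. expectation (\<lambda>\<omega>. (X s \<omega>)\<^sup>2) * (x s \<bullet> (W *v x s)))"
    using I by simp
  also have "\<dots> \<le> (\<Sum>s\<in>I. v * (x s \<bullet> (W *v x s)))"
    using v W by (intro sum_mono mult_right_mono)
  finally show "expectation N \<le> v * (\<Sum>s\<in>I. x s \<bullet> (W *v x s))"
    by (simp add: sum_distrib_left)
qed

subsection \<open>Regret bound\<close>

text \<open>The left side is the bound obtained for the expected squared estimation error. It fits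
  because the square of a sum of nonnegative terms dominates the sum of squares and
  \<open>ln (real T)\<close> is nonnegative.\<close>

lemma conf_radius_sq_ge:
  assumes "0 \<le> tbar" "0 \<le> sigmabar" "0 < glo" "1 \<le> T"
  shows "2 * tbar\<^sup>2 + 4 * sigmabar\<^sup>2 / glo\<^sup>2 * (real d * ln ((real d + real T) / real d))
    \<le> (conf_radius tbar sigmabar glo d T)\<^sup>2"
proof -
  define L where "L = real d * ln ((real d + real T) / real d)"
  have L: "0 \<le> L" unfolding L_def by (cases "d = 0") auto
  have lnT: "0 \<le> ln (real T)" using assms by simp
  define A B where "A = 2 * tbar" and "B = 2 * sigmabar / glo * sqrt (2 * ln (real T) + L)"
  have A: "0 \<le> A" and B: "0 \<le> B" using assms L lnT by (simp_all add: A_def B_def)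
  have "4 * sigmabar\<^sup>2 / glo\<^sup>2 * L \<le> 4 * sigmabar\<^sup>2 / glo\<^sup>2 * (2 * ln (real T) + L)"
    using lnT by (intro mult_left_mono) auto
  also have "\<dots> = B\<^sup>2"
    using L lnT by (simp add: B_def power_mult_distrib power_divide)
  finally have "4 * sigmabar\<^sup>2 / glo\<^sup>2 * L \<le> B\<^sup>2" .
  moreover have "A\<^sup>2 = 4 * tbar\<^sup>2" by (simp add: A_def power_mult_distrib)
  ultimately have "2 * tbar\<^sup>2 + 4 * sigmabar\<^sup>2 / glo\<^sup>2 * L \<le> A\<^sup>2 + B\<^sup>2"
    using zero_le_power2[of tbar] by linarith
  also have "\<dots> \<le> (A + B)\<^sup>2" using A B by (simp add: power2_sum)
  finally show ?thesis by (simp add: conf_radius_def A_def B_def L_def)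
qed

text \<open>In terms of A = d ln n, the logarithmic factor and the squared radius are each O(A) once
  n >= 3, with constants free of d. The bound is therefore O(A^2).\<close>

lemma regret_bound_bigo:
  "(\<lambda>(d, n). regret_bound C tbar sigmabar glo phi Dbar d n)
    \<in> O[large_horizon](\<lambda>(d, n). (real d)\<^sup>2 * (ln (real n))\<^sup>2)"
proof -
  \<comment> \<open>The squared radius is at most \<open>c * A\<close> and \<open>L\<close> at most
    \<open>2 * A\<close>, so the main term of the bound is at most 4 |C| c A^2.\<close>
  define c where "c = 8 * tbar\<^sup>2 + 32 * (sigmabar / glo)\<^sup>2"
  define K where "K = 4 * \<bar>C\<bar> * c + \<bar>phi * Dbar\<bar>"
  have bnd: "\<bar>regret_bound C tbar sigmabar glo phi Dbar d n\<bar> \<le> K * ((real d)\<^sup>2 * (ln (real n))\<^sup>2)"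
    if d: "1 \<le> d" and n: "3 \<le> n" for d n :: nat
  proof -
    define A L where "A = real d * ln (real n)" and "L = real d * ln ((real d + real n) / real d)"
    have "exp 1 \<le> (3 :: real)" by (rule exp_le)
    also have "\<dots> \<le> real n" using n by simp
    finally have ln1: "1 \<le> ln (real n)" using n by (simp add: ln_ge_iff)
    then have A1: "1 \<le> A" using d mult_mono[of 1 "real d" 1 "ln (real n)"] by (simp add: A_def)
    have lnA: "ln (real n) \<le> A" using d ln1 by (simp add: A_def)
    have "(real d + real n) / real d \<le> 1 + real n"
      using d mult_right_mono[of 1 "real d" "real n"] by (simp add: field_simps)
    also have "\<dots> \<le> (real n)\<^sup>2"
    proof -
      have "3 * real n \<le> real n * real n" using n by (intro mult_right_mono) auto
      then show ?thesis using n unfolding power2_eq_square by linarith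
    qed
    finally have "ln ((real d + real n) / real d) \<le> ln ((real n)\<^sup>2)"
      using d by (intro ln_mono) auto
    also have "\<dots> = 2 * ln (real n)" using n by (simp add: ln_realpow)
    finally have LA: "L \<le> 2 * A" using d by (simp add: L_def A_def)
    have L0: "0 \<le> L" unfolding L_def using d by simp
    define B where "B = 2 * sigmabar / glo * sqrt (2 * ln (real n) + L)"
    have "B\<^sup>2 = 4 * (sigmabar / glo)\<^sup>2 * (2 * ln (real n) + L)"
      using L0 ln1 by (simp add: B_def power_mult_distrib power_divide)
    also have "\<dots> \<le> 4 * (sigmabar / glo)\<^sup>2 * (4 * A)"
      using LA lnA by (intro mult_left_mono) auto
    finally have B: "B\<^sup>2 \<le> 16 * (sigmabar / glo)\<^sup>2 * A" by simp
    have "(conf_radius tbar sigmabar glo d n)\<^sup>2 = (2 * tbar + B)\<^sup>2"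
      by (simp add: conf_radius_def B_def L_def)
    also have "\<dots> \<le> 2 * (2 * tbar)\<^sup>2 + 2 * B\<^sup>2"
      using sum_squares_bound[of "2 * tbar" B] by (simp add: power2_sum)
    also have "\<dots> \<le> 8 * tbar\<^sup>2 * A + 32 * (sigmabar / glo)\<^sup>2 * A"
      using B mult_left_mono[OF A1, of "8 * tbar\<^sup>2"] by (simp add: power_mult_distrib)
    finally have R: "(conf_radius tbar sigmabar glo d n)\<^sup>2 \<le> c * A"
      by (simp add: c_def algebra_simps)
    have c: "0 \<le> c" by (simp add: c_def)
    have "\<bar>2 * C * (conf_radius tbar sigmabar glo d n)\<^sup>2 * L\<bar>
        = 2 * \<bar>C\<bar> * ((conf_radius tbar sigmabar glo d n)\<^sup>2 * L)"
      using L0 by (simp add: abs_mult)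
    also have "\<dots> \<le> 2 * \<bar>C\<bar> * ((c * A) * (2 * A))"
      using R LA L0 c A1 by (intro mult_left_mono mult_mono) auto
    finally have 1: "\<bar>2 * C * (conf_radius tbar sigmabar glo d n)\<^sup>2 * L\<bar> \<le> 4 * \<bar>C\<bar> * c * A\<^sup>2"
      by (simp add: power2_eq_square mult_ac)
    have "1 \<le> A\<^sup>2" using A1 by simp
    then have 2: "\<bar>phi * Dbar\<bar> \<le> \<bar>phi * Dbar\<bar> * A\<^sup>2"
      using mult_left_mono[of 1 "A\<^sup>2" "\<bar>phi * Dbar\<bar>"] by simp
    have "regret_bound C tbar sigmabar glo phi Dbar d n
        = 2 * C * (conf_radius tbar sigmabar glo d n)\<^sup>2 * L + phi * Dbar"
      by (simp add: regret_bound_def L_def mult_ac)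
    then have "\<bar>regret_bound C tbar sigmabar glo phi Dbar d n\<bar> \<le> 4 * \<bar>C\<bar> * c * A\<^sup>2 + \<bar>phi * Dbar\<bar> * A\<^sup>2"
      using 1 2 by linarith
    also have "\<dots> = K * ((real d)\<^sup>2 * (ln (real n))\<^sup>2)"
      by (simp add: K_def A_def power_mult_distrib algebra_simps)
    finally show ?thesis .
  qed
  have "eventually (\<lambda>(d, n). 1 \<le> d \<and> 3 \<le> n) large_horizon"
    unfolding large_horizon_def eventually_prod_filter
    by (intro exI[of _ "\<lambda>d. 1 \<le> d"] exI[of _ "\<lambda>n. 3 \<le> n"])
       (auto simp: eventually_principal eventually_ge_at_top)
  then show ?thesis
    by (intro bigoI[of _ K]) (auto elim!: eventually_mono intro!: bnd)
qed

theorem theorem6: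
  fixes M :: "'w measure"
    and X :: "(real ^ 'd) set" and x :: "nat \<Rightarrow> real ^ 'd" and T :: nat
    and g :: "real \<Rightarrow> real" and \<alpha> \<beta> :: "real ^ 'd"
    and plo phi tbar Dbar glo ghi sigmabar C :: real
    and \<epsilon> p :: "nat \<Rightarrow> 'w \<Rightarrow> real" and \<alpha>hat :: "nat \<Rightarrow> 'w \<Rightarrow> real ^ 'd"
    and pstar :: "(real ^ 'd) \<times> (real ^ 'd) \<Rightarrow> real ^ 'd \<Rightarrow> real"
  assumes prob: "prob_space M"
    and horizon: "1 \<le> T"
    and covariates: "\<And>t. t \<in> {1..T} \<Longrightarrow> x t \<in> X"
    and prices: "0 \<le> plo" "plo \<le> phi"
    \<comment> \<open>boundedness\<close>
    and true_param: "0 < tbar" "(\<alpha>, \<beta>) \<in> param_ball tbar"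
    and bounded_mean: "\<And>y q. y \<in> X \<Longrightarrow> q \<in> {plo..phi} \<Longrightarrow>
      0 \<le> g (y \<bullet> \<alpha> + y \<bullet> \<beta> * q) \<and> g (y \<bullet> \<alpha> + y \<bullet> \<beta> * q) \<le> Dbar"
    and bounded_cov: "\<And>y q. y \<in> X \<Longrightarrow> q \<in> {plo..phi} \<Longrightarrow> norm (y, q *\<^sub>R y) \<le> 1"
    \<comment> \<open>link function\<close>
    and link: "strict_mono g" "\<And>z. g differentiable (at z)"
    and link_deriv: "0 < glo" "\<And>y a b q. y \<in> X \<Longrightarrow> (a, b) \<in> param_ball tbar \<Longrightarrow> q \<in> {plo..phi} \<Longrightarrow>
      glo \<le> deriv g (y \<bullet> a + y \<bullet> b * q) \<and> deriv g (y \<bullet> a + y \<bullet> b * q) \<le> ghi"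
    \<comment> \<open>demand shocks\<close>
    and shocks: "0 \<le> sigmabar" "\<And>t. t \<in> {1..T} \<Longrightarrow> \<epsilon> t \<in> borel_measurable M"
    and shock_mean: "\<And>t. t \<in> {1..T} \<Longrightarrow> integrable M (\<epsilon> t) \<and>
      (AE \<omega> in M. real_cond_exp M (history M x p \<epsilon> (t - 1)) (\<epsilon> t) \<omega> = 0)"
    and shock_mgf: "\<And>t s. t \<in> {1..T} \<Longrightarrow> integrable M (\<lambda>\<omega>. exp (s * \<epsilon> t \<omega>)) \<and>
      (AE \<omega> in M. ln (real_cond_exp M (history M x p \<epsilon> (t - 1)) (\<lambda>\<omega>. exp (s * \<epsilon> t \<omega>)) \<omega>)
                    \<le> sigmabar\<^sup>2 * s\<^sup>2 / 2)"
    \<comment> \<open>optimal prices and smoothness, for the known price coefficient \<open>\<beta>\<close>\<close>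
    and optimal: "optimal_price g tbar plo phi X pstar"
    and smooth: "0 \<le> C" "\<And>y a a'. y \<in> X \<Longrightarrow> (a, \<beta>) \<in> param_ball tbar \<Longrightarrow> (a', \<beta>) \<in> param_ball tbar \<Longrightarrow>
      \<bar>opt_revenue g plo phi (y \<bullet> a') (y \<bullet> \<beta>) - revenue g (pstar (a, \<beta>) y) (y \<bullet> a') (y \<bullet> \<beta>)\<bar>
        \<le> C * (y \<bullet> a' - y \<bullet> a)\<^sup>2"
    \<comment> \<open>the pricing policy\<close>
    and nonanticipating: "\<And>t. t \<in> {1..T} \<Longrightarrow> p t \<in> borel_measurable (history M x p \<epsilon> (t - 1))"
    and policy: "certainty_equivalent_run M g \<alpha> \<beta> tbar glo 1 pstar T x p \<epsilon> \<alpha>hat"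
  shows "regret M g \<alpha> \<beta> plo phi T x p \<epsilon> \<le> regret_bound C tbar sigmabar glo phi Dbar CARD('d) T
    \<and> (\<lambda>(d, n). regret_bound C tbar sigmabar glo phi Dbar d n)
        \<in> soft_bigo large_horizon (\<lambda>(d, n). (real d)\<^sup>2 * (ln (real n))\<^sup>2)"
proof
  \<comment> \<open>A plain O bound is available, so the exponent of the extra logarithm is taken to
    be 0.\<close>
  show "(\<lambda>(d, n). regret_bound C tbar sigmabar glo phi Dbar d n)
      \<in> soft_bigo large_horizon (\<lambda>(d, n). (real d)\<^sup>2 * (ln (real n))\<^sup>2)"
    unfolding soft_bigo_def using regret_bound_bigo[of C tbar sigmabar glo phi Dbar]
    by (auto intro!: exI[of _ 0] simp: case_prod_unfold)
  interpret prob_space M by (rule prob)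
  define L where "L = real CARD('d) * ln ((real CARD('d) + real T) / real CARD('d))"
  have L0: "0 \<le> L" unfolding L_def by simp
  have sub: "subalgebra M (history M x p \<epsilon> t)" if "t \<le> T" for t
    using that by (rule subalgebra_history[rotated 2]) (rule shocks(2) nonanticipating, assumption)+
  have x1: "norm (x t) \<le> 1" if "t \<in> {1..T}" for t
    using bounded_cov[OF covariates[OF that], of plo] norm_fst_le[of "x t" "plo *\<^sub>R x t"] prices by simp
  have \<alpha>hat: "(\<alpha>hat (t - 1) \<omega>, \<beta>) \<in> param_ball tbar" if "t \<in> {1..T}" "\<omega> \<in> space M" for t \<omega>
    using policy that unfolding certainty_equivalent_run_def is_arg_max_def by blast
  have p_eq: "p t \<omega> = pstar (\<alpha>hat (t - 1) \<omega>, \<beta>) (x t)" if "t \<in> {1..T}" "\<omega> \<in> space M" for t \<omega>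
    using policy that unfolding certainty_equivalent_run_def by blast
  have p_range: "p t \<omega> \<in> {plo..phi}" if t: "t \<in> {1..T}" and \<omega>: "\<omega> \<in> space M" for t \<omega>
    using optimal \<alpha>hat[OF t \<omega>] covariates[OF t] unfolding optimal_price_def is_arg_max_def p_eq[OF t \<omega>]
    by blast
  have pM: "p t \<in> borel_measurable M" if "t \<in> {1..T}" for t
    using that by (intro measurable_from_subalg[OF sub[of "t - 1"] nonanticipating]) auto

  \<comment> \<open>Second moments and orthogonality of the shocks\<close>
  have sq: "integrable M (\<lambda>\<omega>. (\<epsilon> t \<omega>)\<^sup>2)" and var: "expectation (\<lambda>\<omega>. (\<epsilon> t \<omega>)\<^sup>2) \<le> 2 * sigmabar\<^sup>2"
    if t: "t \<in> {1..T}" for t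
  proof -
    have "expectation (\<lambda>\<omega>. exp (s * \<epsilon> t \<omega>)) \<le> exp (sigmabar\<^sup>2 * s\<^sup>2 / 2)" for s
      using t shock_mgf[OF t, of s] by (intro expectation_le_of_ln_cond_exp_le[OF sub[of "t - 1"]]) auto
    then show "integrable M (\<lambda>\<omega>. (\<epsilon> t \<omega>)\<^sup>2)" "expectation (\<lambda>\<omega>. (\<epsilon> t \<omega>)\<^sup>2) \<le> 2 * sigmabar\<^sup>2"
      using subgaussian_second_moment[OF shocks(2)[OF t]] shock_mgf[OF t] by auto
  qed
  have orth_less: "expectation (\<lambda>\<omega>. \<epsilon> s \<omega> * \<epsilon> r \<omega>) = 0" if "s \<in> {1..T}" "r \<in> {1..T}" "s < r" for s r
    using that shock_mean[of r] sq
    by (intro expectation_mult_cond_mean_zero[OF sub[of "r - 1"] shock_history_measurable])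
       (auto intro!: integrable_mult_of_squares shocks(2))
  have orth: "expectation (\<lambda>\<omega>. \<epsilon> s \<omega> * \<epsilon> r \<omega>) = 0" if "s \<in> {1..T}" "r \<in> {1..T}" "s \<noteq> r" for s r
    using orth_less[of s r] orth_less[of r s] that by (cases "s < r") (auto simp: mult.commute)

  \<comment> \<open>Expected noise in the inverse Gram norm\<close>
  define S where "S t \<omega> = (\<Sum>s=1..t - 1. \<epsilon> s \<omega> *\<^sub>R x s)" for t \<omega>
  define N where "N t \<omega> = S t \<omega> \<bullet> (matrix_inv (gram x (t - 1)) *v S t \<omega>)" for t \<omega>
  have N_int: "integrable M (N t)" and N_le: "expectation (N t) \<le> 2 * sigmabar\<^sup>2 * L"
    if t: "t \<in> {1..T}" for t
  proof -
    let ?W = "matrix_inv (gram x (t - 1))"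
    have mem: "s \<in> {1..T}" if "s \<in> {1..t - 1}" for s using that t by auto
    show "integrable M (N t)"
      unfolding N_def S_def by (rule expectation_quadratic_form_le(1))
        (rule finite_atLeastAtMost shocks(2)[OF mem] sq[OF mem] var[OF mem] orth[OF mem mem]
          inner_matrix_inv_nonneg[OF posdef_gram] | assumption)+
    have "expectation (N t) \<le> 2 * sigmabar\<^sup>2 * (\<Sum>s=1..t - 1. x s \<bullet> (?W *v x s))"
      unfolding N_def S_def by (rule expectation_quadratic_form_le(2))
        (rule finite_atLeastAtMost shocks(2)[OF mem] sq[OF mem] var[OF mem] orth[OF mem mem]
          inner_matrix_inv_nonneg[OF posdef_gram] | assumption)+
    \<comment> \<open>All rounds are weighted by the same matrix, which contains each of them.
      \<open>final_leverage_le_ln\<close> thus gives \<open>L\<close> in the end, without the factor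
      2 of \<open>sum_leverage_le\<close>.\<close>
    also have "\<dots> \<le> 2 * sigmabar\<^sup>2 * (\<Sum>s=1..t - 1. ln (1 + leverage x s))"
      by (intro mult_left_mono sum_mono final_leverage_le_ln) auto
    also have "\<dots> \<le> 2 * sigmabar\<^sup>2 * (\<Sum>s=1..T. ln (1 + leverage x s))"
      using t leverage_nonneg[of x] by (intro mult_left_mono sum_mono2) auto
    also have "\<dots> \<le> 2 * sigmabar\<^sup>2 * L"
      unfolding L_def by (intro mult_left_mono sum_ln_leverage_le x1) auto
    finally show "expectation (N t) \<le> 2 * sigmabar\<^sup>2 * L" .
  qed

  \<comment> \<open>Regret of a single round\<close>
  define rev where "rev t \<omega> = revenue g (p t \<omega>) (x t \<bullet> \<alpha>) (x t \<bullet> \<beta>)" for t \<omega>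
  define opt where "opt t = opt_revenue g plo phi (x t \<bullet> \<alpha>) (x t \<bullet> \<beta>)" for t
  have gap: "opt t - rev t \<omega> \<le> C * leverage x t * (2 * tbar\<^sup>2 + 2 / glo\<^sup>2 * N t \<omega>)"
    if t: "t \<in> {1..T}" and \<omega>: "\<omega> \<in> space M" for t \<omega>
  proof -
    let ?a = "\<alpha>hat (t - 1) \<omega>"
    have "opt t - rev t \<omega> \<le> C * (x t \<bullet> \<alpha> - x t \<bullet> ?a)\<^sup>2"
      using smooth(2)[OF covariates[OF t] \<alpha>hat[OF t \<omega>] true_param(2)]
      by (simp add: opt_def rev_def p_eq[OF t \<omega>])
    also have "x t \<bullet> \<alpha> - x t \<bullet> ?a = x t \<bullet> (\<alpha> - ?a)" by (simp add: inner_diff_right)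
    \<comment> \<open>The squared prediction error splits into a deterministic leverage and the
      random estimation error.\<close>
    also have "C * (x t \<bullet> (\<alpha> - ?a))\<^sup>2
        \<le> C * (leverage x t * ((\<alpha> - ?a) \<bullet> (gram x (t - 1) *v (\<alpha> - ?a))))"
      unfolding leverage_def by (intro mult_left_mono inner_sq_le_dual posdef_gram smooth(1))
    also have "\<dots> \<le> C * (leverage x t * (2 * tbar\<^sup>2 + 2 / glo\<^sup>2 * N t \<omega>))"
    proof (intro mult_left_mono smooth(1) leverage_nonneg)
      show "(\<alpha> - ?a) \<bullet> (gram x (t - 1) *v (\<alpha> - ?a)) \<le> 2 * tbar\<^sup>2 + 2 / glo\<^sup>2 * N t \<omega>"
        unfolding N_def S_def
      proof (rule estimation_error[OF link link_deriv(1) _ true_param(2)])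
        fix s b assume s: "s \<in> {1..t - 1}" and b: "(b, \<beta>) \<in> param_ball tbar"
        then have "s \<in> {1..T}" using t by auto
        then show "glo \<le> deriv g (x s \<bullet> b + x s \<bullet> \<beta> * p s \<omega>)"
          using link_deriv(2)[OF covariates b p_range[OF _ \<omega>]] by blast
      next
        show "is_arg_max
          (\<lambda>a. - (glo / 2) * (norm a)\<^sup>2 + (\<Sum>s=1..t - 1. quasi_loglik g \<beta> (x s) (p s \<omega>)
            (g (x s \<bullet> \<alpha> + x s \<bullet> \<beta> * p s \<omega>) + \<epsilon> s \<omega>) a))
          (\<lambda>a. (a, \<beta>) \<in> param_ball tbar) ?a"
          using policy t \<omega> unfolding certainty_equivalent_run_def demand_def by simp
      qed
    qed
    finally show ?thesis by (simp add: mult.assoc)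
  qed

  \<comment> \<open>Integrability and summation over the rounds\<close>
  have gM: "g \<in> borel_measurable borel"
    using link(2) by (intro borel_measurable_continuous_onI)
      (simp add: continuous_on_eq_continuous_at differentiable_imp_continuous_within)
  have rev_int: "integrable M (rev t)" if t: "t \<in> {1..T}" for t
  proof (rule integrable_const_bound[where B = "phi * Dbar"])
    show "rev t \<in> borel_measurable M"
      unfolding rev_def revenue_def using pM[OF t] measurable_compose[OF _ gM] by measurable
    show "AE \<omega> in M. norm (rev t \<omega>) \<le> phi * Dbar"
    proof (rule AE_I2)
      fix \<omega> assume \<omega>: "\<omega> \<in> space M"
      have pr: "0 \<le> p t \<omega>" "p t \<omega> \<le> phi" using p_range[OF t \<omega>] prices by auto
      then have "p t \<omega> * g (x t \<bullet> \<alpha> + x t \<bullet> \<beta> * p t \<omega>) \<le> phi * Dbar"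
        using bounded_mean[OF covariates[OF t] p_range[OF t \<omega>]] by (intro mult_mono) auto
      then show "norm (rev t \<omega>) \<le> phi * Dbar"
        using bounded_mean[OF covariates[OF t] p_range[OF t \<omega>]] pr by (simp add: rev_def revenue_def)
    qed
  qed
  have p\<epsilon>_int: "integrable M (\<lambda>\<omega>. p t \<omega> * \<epsilon> t \<omega>)" if t: "t \<in> {1..T}" for t
  proof (rule integrable_mult_of_squares[OF pM[OF t] shocks(2)[OF t] _ sq[OF t]])
    show "integrable M (\<lambda>\<omega>. (p t \<omega>)\<^sup>2)"
    proof (rule integrable_const_bound[where B = "phi\<^sup>2"])
      show "AE \<omega> in M. norm ((p t \<omega>)\<^sup>2) \<le> phi\<^sup>2"
        using p_range[OF t] prices by (intro AE_I2) (force intro: power_mono)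
    qed (use pM[OF t] in measurable)
  qed
  have p\<epsilon>: "expectation (\<lambda>\<omega>. p t \<omega> * \<epsilon> t \<omega>) = 0" if t: "t \<in> {1..T}" for t
    using t shock_mean[OF t]
    by (intro expectation_mult_cond_mean_zero[OF sub[of "t - 1"] nonanticipating[OF t] shocks(2)[OF t]
          p\<epsilon>_int[OF t]]) auto
  have "expectation (\<lambda>\<omega>. \<Sum>t=1..T. p t \<omega> * demand g \<alpha> \<beta> x p \<epsilon> t \<omega>)
      = expectation (\<lambda>\<omega>. \<Sum>t=1..T. rev t \<omega> + p t \<omega> * \<epsilon> t \<omega>)"
    by (simp add: demand_def rev_def revenue_def distrib_left)
  also have "\<dots> = (\<Sum>t=1..T. expectation (rev t))"
    using rev_int p\<epsilon>_int p\<epsilon>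
    by (subst Bochner_Integration.integral_sum) (auto intro!: sum.cong)
  finally have "regret M g \<alpha> \<beta> plo phi T x p \<epsilon> = (\<Sum>t=1..T. opt t - expectation (rev t))"
    by (simp add: regret_def opt_def sum_subtractf)
  also have "\<dots> \<le> (\<Sum>t=1..T. C * (conf_radius tbar sigmabar glo CARD('d) T)\<^sup>2 * leverage x t)"
  proof (rule sum_mono)
    fix t assume t: "t \<in> {1..T}"
    have C: "0 \<le> C * leverage x t" by (intro mult_nonneg_nonneg smooth(1) leverage_nonneg)
    have "opt t - expectation (rev t) = expectation (\<lambda>\<omega>. opt t - rev t \<omega>)"
      using rev_int[OF t] by (simp add: prob_space)
    also have "\<dots> \<le> expectation (\<lambda>\<omega>. C * leverage x t * (2 * tbar\<^sup>2 + 2 / glo\<^sup>2 * N t \<omega>))"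
      using rev_int[OF t] N_int[OF t] gap[OF t] by (intro integral_mono) auto
    \<comment> \<open>The leverage leaves the expectation because the covariates are fixed; a second
      moment of the noise is all that remains.\<close>
    also have "\<dots> = C * leverage x t * (2 * tbar\<^sup>2 + 2 / glo\<^sup>2 * expectation (N t))"
      using N_int[OF t] by (simp add: prob_space)
    also have "\<dots> \<le> C * leverage x t * (2 * tbar\<^sup>2 + 2 / glo\<^sup>2 * (2 * sigmabar\<^sup>2 * L))"
      using N_le[OF t] by (intro mult_left_mono add_left_mono C) auto
    also have "\<dots> \<le> C * leverage x t * (conf_radius tbar sigmabar glo CARD('d) T)\<^sup>2"
      using conf_radius_sq_ge[of tbar sigmabar glo T "CARD('d)"] true_param(1) shocks(1) link_deriv(1) horizon
      by (intro mult_left_mono C) (simp add: L_def)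
    finally show "opt t - expectation (rev t)
        \<le> C * (conf_radius tbar sigmabar glo CARD('d) T)\<^sup>2 * leverage x t" by (simp add: mult_ac)
  qed
  also have "\<dots> = C * (conf_radius tbar sigmabar glo CARD('d) T)\<^sup>2 * (\<Sum>t=1..T. leverage x t)"
    by (simp add: sum_distrib_left)
  also have "\<dots> \<le> C * (conf_radius tbar sigmabar glo CARD('d) T)\<^sup>2 * (2 * L)"
    unfolding L_def using smooth(1) by (intro mult_left_mono sum_leverage_le x1) auto
  finally have "regret M g \<alpha> \<beta> plo phi T x p \<epsilon>
      \<le> C * (conf_radius tbar sigmabar glo CARD('d) T)\<^sup>2 * (2 * L)" .
  \<comment> \<open>Round 1 at price \<open>plo\<close> shows that \<open>Dbar\<close> is
    nonnegative.\<close>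
  moreover have "0 \<le> phi * Dbar"
    using bounded_mean[OF covariates[of 1], of plo] horizon prices
    by (intro mult_nonneg_nonneg) auto
  ultimately show "regret M g \<alpha> \<beta> plo phi T x p \<epsilon>
      \<le> regret_bound C tbar sigmabar glo phi Dbar CARD('d) T"
    by (simp add: regret_bound_def L_def mult_ac)
qed

end
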